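(* Let $A$ be an $n\times n$ M-matrix. Let $S_1,\dots,S_m$ be the singular classes of $A$, ordered so that $\max(S_i)<\max(S_{i+1})$, let $\mu_i=\max(S_i)$, and let $F_i,T_i$ ($1\le i\le m$) be the associated sets defined in the context. Then the following are equivalent: (i) $A$ admits a factorization $A=LU$, where $L$ is a lower triangular M-matrix and $U$ is an upper triangular M-matrix (both possibly singular). (ii) For every $i\in\{1,\dots,m\}$, either $T_i=\{\mu_i\}$ or $F_i=\{\mu_i\}$.
   Context: All matrices are real $n\times n$, and $\langle n\rangle=\{1,\dots,n\}$. An M-matrix is a matrix of the form $\alpha I-P$ with $P$ entrywise nonnegative and $\alpha\in\mathbb{R}$ at least the spectral radius of $P$ (so M-matrices may be singular). The directed graph $\mathcal{G}(X)$ of $X=[x_{ij}]$ has vertex set $\langle n\rangle$ and edges $\{(i,j): x_{ij}\neq 0\}$. A vertex $j$ has access to $k$ (equivalently, $k$ is accessed from $j$) if there is a directed path from $j$ to $k$; the empty path is allowed, so every vertex has access to itself. The classes of $X$ are the equivalence classes of the relation "$j$ has access to $k$ and $k$ has access to $j$" in $\mathcal{G}(X)$. A class $J$ of $X$ is a singular class of $X$ if the principal submatrix $X_{JJ}$ (rows and columns indexed by $J$) is singular. A vertex has access to (is accessed from) a class if it has access to (is accessed from) some vertex of it. With $S_1,\dots,S_m$ the singular classes of $A$ ordered by $\max(S_i)<\max(S_{i+1})$ and $\mu_i=\max(S_i)$, $$F_i=\{l\ge\mu_i : \text{there is } j\ge l \text{ such that } j \text{ is accessed from } S_i \text{ in }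 \mathcal{G}(A)\},$$ $$T_i=\{l\ge\mu_i : \text{there is } j\ge l \text{ such that } j \text{ has access to } S_i \text{ in } \mathcal{G}(A)\}.$$ *)

theory Defs
  imports
    "Jordan_Normal_Form.Determinant"
    "Jordan_Normal_Form.DL_Submatrix"
    "Jordan_Normal_Form.Spectral_Radius"
begin

text \<open>Vertices are the matrix indices of \<^typ>\<open>'a mat\<close>, that is \<^term>\<open>{..<n}\<close> instead of
  \<^term>\<open>{1..n}\<close>; only their order matters below.\<close>

definition M_matrix :: "real mat \<Rightarrow> bool" where
  "M_matrix A \<longleftrightarrow> (\<exists>\<alpha> P.
     P \<in> carrier_mat (dim_row A) (dim_row A) \<and>
     (\<forall>i < dim_row A. \<forall>j < dim_row A. 0 \<le> P $$ (i, j)) \<and>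
     spectral_radius (map_mat complex_of_real P) \<le> \<alpha> \<and>
     A = (\<alpha> \<cdot>\<^sub>m 1\<^sub>m (dim_row A)) - P)"

definition lower_triangular :: "'a::zero mat \<Rightarrow> bool" where
  "lower_triangular A \<longleftrightarrow> (\<forall>i < dim_row A. \<forall>j < dim_col A. i < j \<longrightarrow> A $$ (i, j) = 0)"

definition edges :: "'a::zero mat \<Rightarrow> (nat \<times> nat) set" where
  "edges A = {(i, j). i < dim_row A \<and> j < dim_col A \<and> A $$ (i, j) \<noteq> 0}"

definition has_access :: "'a::zero mat \<Rightarrow> nat \<Rightarrow> nat \<Rightarrow> bool" where
  "has_access A j k \<longleftrightarrow> j < dim_row A \<and> k < dim_row A \<and> (j, k) \<in> (edges A)\<^sup>*"

definition access_classes :: "'a::zero mat \<Rightarrow> nat set set" where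
  "access_classes A = {..<dim_row A} // {(j, k). has_access A j k \<and> has_access A k j}"

definition singular_classes :: "'a::comm_ring_1 mat \<Rightarrow> nat set set" where
  "singular_classes A = {J \<in> access_classes A. det (submatrix A J J) = 0}"

definition has_access_to_class :: "'a::zero mat \<Rightarrow> nat \<Rightarrow> nat set \<Rightarrow> bool" where
  "has_access_to_class A j J \<longleftrightarrow> (\<exists>k \<in> J. has_access A j k)"

definition accessed_from_class :: "'a::zero mat \<Rightarrow> nat \<Rightarrow> nat set \<Rightarrow> bool" where
  "accessed_from_class A j J \<longleftrightarrow> (\<exists>k \<in> J. has_access A k j)"

definition F_set :: "'a::zero mat \<Rightarrow> nat set \<Rightarrow> nat set" where
  "F_set A J = {l. l < dim_row A \<and> Max J \<le> l \<and> (\<exists>j \<ge> l. accessed_from_class A j J)}"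

definition T_set :: "'a::zero mat \<Rightarrow> nat set \<Rightarrow> nat set" where
  "T_set A J = {l. l < dim_row A \<and> Max J \<le> l \<and> (\<exists>j \<ge> l. has_access_to_class A j J)}"

end

theory Submission
  imports Defs
begin

text \<open>
  Gaussian elimination proves both directions. A matrix is treated here as a real function of two
  indices from a finite set; eliminating the least index \<open>k\<close> then leaves a function on the set
  without \<open>k\<close>, and all inductions are over index sets.

  The spectral radius is replaced by positive vectors: a matrix with nonpositive off-diagonal
  entries is an M-matrix iff for each \<open>\<epsilon> > 0\<close> there is \<open>x > 0\<close> with \<open>A x > - \<epsilon> x\<close>, and a principal
  submatrix of an M-matrix is nonsingular iff some \<open>x > 0\<close> has a positive image
  (\<open>M_matrix_iff_M_on\<close>, \<open>det_submatrix_eq_0_iff\<close>). Condition (ii) says that for the greatest index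
  \<open>s\<close> of a singular class, either no later index has access to \<open>s\<close> or no later index is accessed
  from \<open>s\<close>; this is \<open>one_sided\<close>.

  Suppose that the pivot \<open>a\<^sub>k\<^sub>k\<close> is positive, or that it is zero and column \<open>k\<close> or row \<open>k\<close> has no other
  nonzero entry (\<open>eliminable\<close>). Eliminating \<open>k\<close> gives again an M-matrix, does not change access
  among the remaining indices (off the diagonal, elimination subtracts nonnegative numbers from
  nonpositive ones, so nothing cancels), and keeps singular or nonsingular every class other than
  \<open>{k}\<close>. The class \<open>{k}\<close> is nonsingular or, if the pivot is zero, satisfies the condition in (ii)
  because its row or column vanishes. Hence (ii) holds before the step iff it holds after it
  (\<open>one_sided_schur\<close>).

  From (ii) to (i): an index with zero pivot is a singular class by itself, since an index on a
  cycle of an M-matrix has a positive diagonal entry. Condition (ii) at this class makes the index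
  eliminable, so elimination runs to the end and yields the factors
  (\<open>one_sided_imp_factorization\<close>).

  From (i) to (ii): if \<open>A = L U\<close>, then the least index is eliminable, and the product \<open>B\<close> of the
  trailing blocks of \<open>L\<close> and \<open>U\<close> is entrywise at most the eliminated matrix. The two differ only
  when the pivot vanishes. \<open>B\<close> is again an M-matrix (\<open>M_on_product\<close>), satisfies (ii) by induction,
  and (ii) passes from \<open>B\<close> to any greater matrix with nonpositive off-diagonal entries
  (\<open>one_sided_mono\<close>): a singular class of the greater matrix is already a singular class of \<open>B\<close>,
  because proper principal submatrices of an irreducible M-matrix are nonsingular
  (\<open>irreducible_proper_semipos\<close>).\<close>

section \<open>M-matrices over a finite index set\<close>

text \<open>The off-diagonal entries with indices in \<open>I\<close> are nonpositive.\<close>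
definition Z_on :: "'v set \<Rightarrow> ('v \<Rightarrow> 'v \<Rightarrow> real) \<Rightarrow> bool" where
  "Z_on I a \<longleftrightarrow> (\<forall>i\<in>I. \<forall>j\<in>I. i \<noteq> j \<longrightarrow> a i j \<le> 0)"

text \<open>Semipositivity: some positive vector has a positive image. Among M-matrices these are the
  nonsingular ones.\<close>
definition semipos_on :: "'v set \<Rightarrow> ('v \<Rightarrow> 'v \<Rightarrow> real) \<Rightarrow> bool" where
  "semipos_on I a \<longleftrightarrow> (\<exists>x. \<forall>i\<in>I. 0 < x i \<and> 0 < (\<Sum>j\<in>I. a i j * x j))"

text \<open>The positive vector \<open>x\<close> witnesses that \<open>a + \<epsilon> 1\<close> is semipositive.\<close>
definition almost_semipos :: "'v set \<Rightarrow> ('v \<Rightarrow> 'v \<Rightarrow> real) \<Rightarrow> real \<Rightarrow> ('v \<Rightarrow> real) \<Rightarrow> bool" where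
  "almost_semipos I a \<epsilon> x \<longleftrightarrow> (\<forall>i\<in>I. 0 < x i \<and> - \<epsilon> * x i < (\<Sum>j\<in>I. a i j * x j))"

text \<open>M-matrices, singular ones included, described by positive vectors instead of a spectral radius.\<close>
definition M_on :: "'v set \<Rightarrow> ('v \<Rightarrow> 'v \<Rightarrow> real) \<Rightarrow> bool" where
  "M_on I a \<longleftrightarrow> Z_on I a \<and> (\<forall>\<epsilon>>0. \<exists>x. almost_semipos I a \<epsilon> x)"

lemma Z_onD: "Z_on I a \<Longrightarrow> i \<in> I \<Longrightarrow> j \<in> I \<Longrightarrow> i \<noteq> j \<Longrightarrow> a i j \<le> 0"
  by (simp add: Z_on_def)

lemma Z_on_subset: "Z_on I a \<Longrightarrow> J \<subseteq> I \<Longrightarrow> Z_on J a"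
  by (auto simp: Z_on_def)

lemma M_on_Z: "M_on I a \<Longrightarrow> Z_on I a"
  by (simp add: M_on_def)

lemma almost_semiposD:
  assumes "almost_semipos I a \<epsilon> x" "i \<in> I"
  shows "0 < x i" "- \<epsilon> * x i < (\<Sum>j\<in>I. a i j * x j)"
  using assms by (auto simp: almost_semipos_def)

text \<open>Dropping off-diagonal terms increases a row sum against a nonnegative vector. Most estimates
  below are instances of this.\<close>
lemma row_sum_subset_le:
  assumes "finite I" "Z_on I a" "J \<subseteq> I" "i \<in> J" "\<And>j. j \<in> I \<Longrightarrow> 0 \<le> x j"
  shows "(\<Sum>j\<in>I. a i j * x j) \<le> (\<Sum>j\<in>J. a i j * x j)"
proof -
  have "(\<Sum>j\<in>I. a i j * x j) = (\<Sum>j\<in>J. a i j * x j) + (\<Sum>j\<in>I-J. a i j * x j)"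
    using assms by (metis add.commute sum.subset_diff)
  moreover have "(\<Sum>j\<in>I-J. a i j * x j) \<le> 0"
  proof (rule sum_nonpos)
    fix j assume "j \<in> I - J"
    then have "a i j \<le> 0" "0 \<le> x j" using assms by (auto intro: Z_onD)
    then show "a i j * x j \<le> 0" by (simp add: mult_nonpos_nonneg)
  qed
  ultimately show ?thesis by linarith
qed

lemma row_sum_le_diag:
  assumes "finite I" "Z_on I a" "i \<in> I" "\<And>j. j \<in> I \<Longrightarrow> 0 \<le> x j"
  shows "(\<Sum>j\<in>I. a i j * x j) \<le> a i i * x i"
  using row_sum_subset_le[of I a "{i}" i x] assms by auto

lemma row_sum_le_two:
  assumes "finite I" "Z_on I a" "i \<in> I" "k \<in> I" "i \<noteq> k" "\<And>j. j \<in> I \<Longrightarrow> 0 \<le> x j"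
  shows "(\<Sum>j\<in>I. a i j * x j) \<le> a i i * x i + a i k * x k"
  using row_sum_subset_le[of I a "{i,k}" i x] assms by auto

lemma semipos_on_subset:
  assumes "finite I" "Z_on I a" "semipos_on I a" "J \<subseteq> I"
  shows "semipos_on J a"
proof -
  from assms(3) obtain x where x: "\<forall>i\<in>I. 0 < x i \<and> 0 < (\<Sum>j\<in>I. a i j * x j)"
    by (auto simp: semipos_on_def)
  then have "(\<Sum>j\<in>I. a i j * x j) \<le> (\<Sum>j\<in>J. a i j * x j)" if "i \<in> J" for i
    using assms that by (intro row_sum_subset_le) (auto intro: less_imp_le)
  then show ?thesis unfolding semipos_on_def
    using x assms(4) by (intro exI[of _ x]) (meson less_le_trans subsetD)
qed

lemma M_on_subset:
  assumes "finite I" "M_on I a" "J \<subseteq> I"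
  shows "M_on J a"
  unfolding M_on_def
proof (intro conjI allI impI)
  show "Z_on J a" using assms Z_on_subset M_on_Z by blast
  fix \<epsilon> :: real assume "0 < \<epsilon>"
  then obtain x where x: "almost_semipos I a \<epsilon> x" using assms by (auto simp: M_on_def)
  then have "(\<Sum>j\<in>I. a i j * x j) \<le> (\<Sum>j\<in>J. a i j * x j)" if "i \<in> J" for i
    using assms that
    by (intro row_sum_subset_le) (auto intro: less_imp_le dest: almost_semiposD M_on_Z)
  then show "\<exists>x. almost_semipos J a \<epsilon> x"
    using x assms(3) unfolding almost_semipos_def
    by (intro exI[of _ x]) (meson less_le_trans subsetD)
qed

lemma row_sum_mono:
  assumes "\<And>j. j \<in> I \<Longrightarrow> b i j \<le> a i j" "\<And>j. j \<in> I \<Longrightarrow> 0 \<le> x j"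
  shows "(\<Sum>j\<in>I. b i j * x j) \<le> (\<Sum>j\<in>I. a i j * x j :: real)"
  using assms by (intro sum_mono mult_right_mono) auto

lemma row_sum_shift:
  fixes a :: "'v \<Rightarrow> 'v \<Rightarrow> real"
  assumes "finite I" "i \<in> I"
  shows "(\<Sum>j\<in>I. (if i = j then a i j + \<eta> else a i j) * x j) = (\<Sum>j\<in>I. a i j * x j) + \<eta> * x i"
proof -
  have "(\<Sum>j\<in>I. (if i = j then a i j + \<eta> else a i j) * x j)
      = (\<Sum>j\<in>I. a i j * x j + (if i = j then \<eta> * x j else 0))"
    by (intro sum.cong) (auto simp: algebra_simps)
  then show ?thesis using assms by (simp add: sum.distrib)
qed

lemma semipos_on_mono:
  assumes "semipos_on I b" "\<And>i j. i \<in> I \<Longrightarrow> j \<in> I \<Longrightarrow> b i j \<le> a i j"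
  shows "semipos_on I a"
proof -
  from assms(1) obtain x where x: "\<forall>i\<in>I. 0 < x i \<and> 0 < (\<Sum>j\<in>I. b i j * x j)"
    by (auto simp: semipos_on_def)
  have "(\<Sum>j\<in>I. b i j * x j) \<le> (\<Sum>j\<in>I. a i j * x j)" if "i \<in> I" for i
    using that x assms(2) by (intro row_sum_mono) (auto intro: less_imp_le)
  then show ?thesis unfolding semipos_on_def
    using x by (intro exI[of _ x]) (meson less_le_trans)
qed

lemma semipos_on_cong:
  assumes "\<And>i j. i \<in> I \<Longrightarrow> j \<in> I \<Longrightarrow> b i j = a i j"
  shows "semipos_on I b \<longleftrightarrow> semipos_on I a"
  using assms by (auto intro: semipos_on_mono)

lemma semipos_on_singleton: "semipos_on {k} a \<longleftrightarrow> 0 < a k k"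
  unfolding semipos_on_def
  by (auto simp: zero_less_mult_iff intro: exI[of _ "\<lambda>_. 1"])

lemma M_on_diag_nonneg:
  assumes "finite I" "M_on I a" "i \<in> I"
  shows "0 \<le> a i i"
proof (rule ccontr)
  assume "\<not> 0 \<le> a i i"
  then obtain x where x: "almost_semipos I a (- a i i) x"
    using assms by (force simp: M_on_def)
  have "(\<Sum>j\<in>I. a i j * x j) \<le> a i i * x i"
    using assms x
    by (intro row_sum_le_diag) (auto intro: less_imp_le dest: almost_semiposD M_on_Z)
  with almost_semiposD(2)[OF x assms(3)] show False by simp
qed

text \<open>A semipositive matrix with nonpositive off-diagonal entries is monotone: compare \<open>y\<close> with the
  multiple \<open>t x\<close> of the semipositivity vector \<open>x\<close>, where \<open>t\<close> is the least ratio \<open>y\<^sub>i / x\<^sub>i\<close>.\<close>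
lemma semipos_imp_inverse_nonneg:
  assumes "finite I" "Z_on I a" "semipos_on I a"
    and y: "\<And>i. i \<in> I \<Longrightarrow> 0 \<le> (\<Sum>j\<in>I. a i j * y j)" and "i \<in> I"
  shows "0 \<le> y i"
proof (rule ccontr)
  assume neg: "\<not> 0 \<le> y i"
  from assms(3) obtain x where x: "\<forall>i\<in>I. 0 < x i \<and> 0 < (\<Sum>j\<in>I. a i j * x j)"
    by (auto simp: semipos_on_def)
  define t where "t = Min ((\<lambda>i. y i / x i) ` I)"
  have "t \<in> (\<lambda>i. y i / x i) ` I" unfolding t_def using assms by (intro Min_in) auto
  then obtain m where m: "m \<in> I" "t = y m / x m" by auto
  have le: "t \<le> y j / x j" if "j \<in> I" for j
    unfolding t_def using assms that by (intro Min_le) auto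
  have "y i / x i < 0" using neg x assms(5) by (simp add: divide_neg_pos)
  with le[OF assms(5)] have "t < 0" by linarith
  have nn: "0 \<le> y j - t * x j" if "j \<in> I" for j
    using le[OF that] x that by (simp add: field_simps)
  have "(\<Sum>j\<in>I. a m j * (y j - t * x j)) \<le> a m m * (y m - t * x m)"
    using nn m assms by (intro row_sum_le_diag) auto
  also have "\<dots> = 0" using m x by fastforce
  finally have "(\<Sum>j\<in>I. a m j * y j) \<le> t * (\<Sum>j\<in>I. a m j * x j)"
    by (simp add: algebra_simps sum_subtractf sum_distrib_left)
  moreover have "t * (\<Sum>j\<in>I. a m j * x j) < 0"
    using \<open>t < 0\<close> x m(1) by (intro mult_neg_pos) auto
  ultimately show False using y[OF m(1)] by linarith
qed

text \<open>This is how nonsingularity of an M-matrix enters: it provides a solution of \<open>a y = 1\<close>. The same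
  \<open>y\<close> is mapped to a nonnegative vector by \<open>a + \<epsilon> 1\<close> for small \<open>\<epsilon>\<close>, and \<open>a + \<epsilon> 1\<close> is monotone, so
  \<open>y\<close> is nonnegative.\<close>
lemma M_on_solution_imp_semipos:
  assumes "finite I" "M_on I a" and y: "\<And>i. i \<in> I \<Longrightarrow> (\<Sum>j\<in>I. a i j * y j) = 1"
  shows "semipos_on I a"
proof -
  define \<epsilon> where "\<epsilon> = 1 / (1 + (\<Sum>j\<in>I. \<bar>y j\<bar>))"
  have s: "0 < 1 + (\<Sum>j\<in>I. \<bar>y j\<bar>)" by (simp add: add_pos_nonneg sum_nonneg)
  have e: "0 < \<epsilon>" unfolding \<epsilon>_def using s by simp
  define b where "b i j = (if i = j then a i j + \<epsilon> else a i j)" for i j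
  have b: "(\<Sum>j\<in>I. b i j * x j) = (\<Sum>j\<in>I. a i j * x j) + \<epsilon> * x i" if "i \<in> I" for i x
    unfolding b_def using assms(1) that by (rule row_sum_shift)
  obtain x where x: "almost_semipos I a \<epsilon> x" using e assms(2) by (auto simp: M_on_def)
  have "semipos_on I b" unfolding semipos_on_def
  proof (intro exI[of _ x] ballI conjI)
    fix i assume "i \<in> I"
    then show "0 < x i" "0 < (\<Sum>j\<in>I. b i j * x j)"
      using almost_semiposD[OF x, of i] b[of i x] by auto
  qed
  moreover have "Z_on I b" using M_on_Z[OF assms(2)] by (auto simp: Z_on_def b_def)
  moreover have "0 \<le> (\<Sum>j\<in>I. b i j * y j)" if "i \<in> I" for i
  proof -
    have "\<bar>y i\<bar> \<le> (\<Sum>j\<in>I. \<bar>y j\<bar>)" using that assms(1) by (intro member_le_sum) auto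
    then have "\<bar>y i\<bar> \<le> 1 + (\<Sum>j\<in>I. \<bar>y j\<bar>)" by simp
    then have "\<epsilon> * \<bar>y i\<bar> \<le> 1" unfolding \<epsilon>_def using s by simp
    then have "\<bar>\<epsilon> * y i\<bar> \<le> 1" using e by (simp add: abs_mult)
    then have "- 1 \<le> \<epsilon> * y i" by linarith
    then show ?thesis using b[OF that, of y] y[OF that] by simp
  qed
  ultimately have nn: "0 \<le> y i" if "i \<in> I" for i
    using semipos_imp_inverse_nonneg[OF assms(1), of b y i] that by blast
  show ?thesis unfolding semipos_on_def
  proof (intro exI[of _ y] ballI conjI)
    fix i assume i: "i \<in> I"
    have "1 \<le> a i i * y i"
      using row_sum_le_diag[OF assms(1) M_on_Z[OF assms(2)] i, of y] nn y[OF i] by simp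
    then show "0 < y i" using nn[OF i] by (cases "y i = 0") auto
    show "0 < (\<Sum>j\<in>I. a i j * y j)" using y[OF i] by simp
  qed
qed

section \<open>Access and classes\<close>

text \<open>\<open>i\<close> has access to \<open>j\<close> along edges between indices in \<open>I\<close>. Every index, even outside \<open>I\<close>, has access
  to itself.\<close>
definition access_on :: "'v set \<Rightarrow> ('v \<Rightarrow> 'v \<Rightarrow> real) \<Rightarrow> 'v \<Rightarrow> 'v \<Rightarrow> bool" where
  "access_on I a i j \<longleftrightarrow> (i, j) \<in> {(i, j). i \<in> I \<and> j \<in> I \<and> a i j \<noteq> 0}\<^sup>*"

text \<open>The class of \<open>s\<close> in the graph on \<open>I\<close>.\<close>
definition class_on :: "'v set \<Rightarrow> ('v \<Rightarrow> 'v \<Rightarrow> real) \<Rightarrow> 'v \<Rightarrow> 'v set" where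
  "class_on I a s = {t \<in> I. access_on I a s t \<and> access_on I a t s}"

lemma access_on_refl [simp]: "access_on I a i i"
  by (simp add: access_on_def)

lemma access_on_trans: "access_on I a i j \<Longrightarrow> access_on I a j k \<Longrightarrow> access_on I a i k"
  unfolding access_on_def by (rule rtrancl_trans)

lemma access_on_edge: "i \<in> I \<Longrightarrow> j \<in> I \<Longrightarrow> a i j \<noteq> 0 \<Longrightarrow> access_on I a i j"
  unfolding access_on_def by (rule r_into_rtrancl) auto

lemma access_on_induct [consumes 1, case_names refl step]:
  assumes "access_on I a i j" "P i"
    and "\<And>p q. access_on I a i p \<Longrightarrow> p \<in> I \<Longrightarrow> q \<in> I \<Longrightarrow> a p q \<noteq> 0 \<Longrightarrow> P p \<Longrightarrow> P q"
  shows "P j"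
  using assms(1) unfolding access_on_def
  by (induction rule: rtrancl_induct) (use assms in \<open>auto simp: access_on_def\<close>)

lemma access_on_first_edge:
  assumes "access_on I a i j" "i \<noteq> j"
  obtains p where "i \<in> I" "p \<in> I" "a i p \<noteq> 0" "access_on I a p j"
  using assms unfolding access_on_def by (auto elim: converse_rtranclE)

lemma access_on_last_edge:
  assumes "access_on I a i j" "i \<noteq> j"
  obtains p where "j \<in> I" "p \<in> I" "a p j \<noteq> 0" "access_on I a i p"
  using assms unfolding access_on_def by (auto elim: rtranclE)

lemma access_on_mono:
  assumes "access_on I a i j" 
    and "\<And>p q. p \<in> I \<Longrightarrow> q \<in> I \<Longrightarrow> p \<noteq> q \<Longrightarrow> a p q \<noteq> 0 \<Longrightarrow> access_on J b p q"
  shows "access_on J b i j"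
  using assms(1)
proof (induction rule: access_on_induct)
  case refl
  then show ?case by simp
next
  case (step p q)
  then show ?case using assms(2)[of p q] access_on_trans[of J b i p q] by (cases "p = q") auto
qed

lemma self_in_class_on: "s \<in> I \<Longrightarrow> s \<in> class_on I a s"
  by (simp add: class_on_def)

text \<open>A path between two members of a class stays in the class.\<close>
lemma access_on_within_class:
  assumes "access_on I a i j" "i \<in> class_on I a s" "j \<in> class_on I a s"
  shows "access_on (class_on I a s) a i j"
proof -
  have "access_on I a i j \<and> (access_on I a j s \<longrightarrow> access_on (class_on I a s) a i j)"
    using assms(1)
  proof (induction rule: access_on_induct)
    case refl
    then show ?case by simp
  next
    case (step p q)
    then have e: "access_on I a p q" by (simp add: access_on_edge)
    show ?case
    proof (intro conjI impI)
      show "access_on I a i q" using step e access_on_trans by metis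
      assume qs: "access_on I a q s"
      have "access_on I a p s" using e qs by (rule access_on_trans)
      moreover have "access_on I a s p" using step.hyps(1) assms(2) access_on_trans[of I a s i p]
        by (simp add: class_on_def)
      moreover have "access_on I a s q" using calculation(2) e by (rule access_on_trans)
      ultimately have "p \<in> class_on I a s" "q \<in> class_on I a s"
        using step.hyps qs by (auto simp: class_on_def)
      then have "access_on (class_on I a s) a p q" using step.hyps by (intro access_on_edge)
      moreover have "access_on (class_on I a s) a i p" using step.IH \<open>access_on I a p s\<close> by simp
      ultimately show "access_on (class_on I a s) a i q" using access_on_trans by metis
    qed
  qed
  then show ?thesis using assms(3) by (simp add: class_on_def)
qed

text \<open>If \<open>j\<close> has access to \<open>i\<close>, then \<open>x\<^sub>i\<close> is bounded by a multiple of \<open>x\<^sub>j\<close>, with a factor that depends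
  neither on \<open>\<epsilon> \<le> 1\<close> nor on \<open>x\<close>. This uniformity replaces a passage to the limit \<open>\<epsilon> \<rightarrow> 0\<close>, that is, the
  Perron vector.\<close>
lemma M_on_harnack:
  assumes "finite I" "M_on I a" "access_on I a j i" 
  shows "\<exists>C>0. \<forall>\<epsilon> x. 0 < \<epsilon> \<longrightarrow> \<epsilon> \<le> 1 \<longrightarrow> almost_semipos I a \<epsilon> x \<longrightarrow> j \<in> I \<longrightarrow> x i \<le> C * x j"
  using assms(3)
proof (induction rule: access_on_induct)
  case refl
  then show ?case by (intro exI[of _ 1]) auto
next
  case (step p q)
  then obtain C where C: "C > 0" 
    "\<And>\<epsilon> x. 0 < \<epsilon> \<Longrightarrow> \<epsilon> \<le> 1 \<Longrightarrow> almost_semipos I a \<epsilon> x \<Longrightarrow> j \<in> I \<Longrightarrow> x p \<le> C * x j" by blast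
  show ?case
  proof (cases "p = q")
    case True
    then show ?thesis using step.IH by simp
  next
    case False
    have neg: "a p q < 0" 
      using Z_onD[OF M_on_Z[OF assms(2)] step.hyps(2,3) False] step.hyps(4) by simp
    define D where "D = (a p p + 1) / (- a p q)"
    have "D > 0" unfolding D_def using neg M_on_diag_nonneg[OF assms(1,2) step.hyps(2)]
      by (intro divide_pos_pos) auto
    show ?thesis
    proof (intro exI[of _ "D * C"] conjI allI impI)
      show "0 < D * C" using C \<open>D > 0\<close> by simp
      fix \<epsilon> :: real and x assume e: "0 < \<epsilon>" "\<epsilon> \<le> 1" "almost_semipos I a \<epsilon> x" "j \<in> I"
      have pos: "0 < x t" if "t \<in> I" for t using almost_semiposD(1)[OF e(3) that] .
      have "- \<epsilon> * x p < (\<Sum>j\<in>I. a p j * x j)" using almost_semiposD(2)[OF e(3) step.hyps(2)] .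
      also have "\<dots> \<le> a p p * x p + a p q * x q"
        using assms step.hyps False pos
        by (intro row_sum_le_two) (auto intro: less_imp_le M_on_Z)
      finally have "- a p q * x q \<le> (a p p + \<epsilon>) * x p" by (simp add: algebra_simps)
      also have "\<dots> \<le> (a p p + 1) * x p"
        using e pos[OF step.hyps(2)] by (intro mult_right_mono) auto
      finally have "x q \<le> D * x p" unfolding D_def using neg by (simp add: field_simps)
      also have "\<dots> \<le> D * (C * x j)" using C(2)[OF e] \<open>D > 0\<close> by simp
      finally show "x q \<le> D * C * x j" by simp
    qed
  qed
qed

text \<open>Row \<open>i\<close> gives \<open>- a\<^sub>i\<^sub>j x\<^sub>j < \<epsilon> x\<^sub>i\<close>, which contradicts the uniform bound of \<open>x\<^sub>i\<close> by \<open>x\<^sub>j\<close> once \<open>\<epsilon>\<close> is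
  small.\<close>
lemma zero_diag_no_cycle:
  assumes "finite I" "M_on I a" "i \<in> I" "j \<in> I" "i \<noteq> j" "a i i = 0" "a i j \<noteq> 0"
  shows "\<not> access_on I a j i"
proof
  assume "access_on I a j i"
  from M_on_harnack[OF assms(1,2) this] assms(4) obtain C where C: "C > 0"
    "\<And>\<epsilon> x. 0 < \<epsilon> \<Longrightarrow> \<epsilon> \<le> 1 \<Longrightarrow> almost_semipos I a \<epsilon> x \<Longrightarrow> x i \<le> C * x j" by blast
  have neg: "a i j < 0" using Z_onD[OF M_on_Z[OF assms(2)] assms(3-5)] assms(7) by simp
  define \<epsilon> where "\<epsilon> = min 1 (- a i j / C)"
  have e: "0 < \<epsilon>" "\<epsilon> \<le> 1" "\<epsilon> * C \<le> - a i j"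
    using C(1) neg by (auto simp: \<epsilon>_def min_def field_simps)
  obtain x where x: "almost_semipos I a \<epsilon> x" using e(1) assms(2) by (auto simp: M_on_def)
  have pos: "0 < x t" if "t \<in> I" for t using almost_semiposD(1)[OF x that] .
  have "- \<epsilon> * x i < (\<Sum>j\<in>I. a i j * x j)" using almost_semiposD(2)[OF x assms(3)] .
  also have "\<dots> \<le> a i i * x i + a i j * x j"
    using assms pos by (intro row_sum_le_two) (auto intro: less_imp_le M_on_Z)
  finally have "- a i j * x j < \<epsilon> * x i" using assms by simp
  also have "\<dots> \<le> \<epsilon> * (C * x j)" using C(2)[OF e(1,2) x] e(1) by simp
  also have "\<dots> = (\<epsilon> * C) * x j" by simp
  also have "\<dots> \<le> - a i j * x j" using e(3) pos[OF assms(4)] by (intro mult_right_mono) auto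
  finally show False by simp
qed

lemma class_on_zero_diag:
  assumes "finite I" "M_on I a" "i \<in> I" "a i i = 0"
  shows "class_on I a i = {i}"
proof -
  have "t = i" if t: "t \<in> class_on I a i" for t
  proof (rule ccontr)
    assume "t \<noteq> i"
    with t obtain p where p: "p \<in> I" "a i p \<noteq> 0" "access_on I a p t"
      unfolding class_on_def by (metis (no_types, lifting) access_on_first_edge mem_Collect_eq)
    have "access_on I a t i" using t by (simp add: class_on_def)
    with p(3) have "access_on I a p i" by (rule access_on_trans)
    moreover have "p \<noteq> i" using p assms by auto
    ultimately show False using zero_diag_no_cycle[of I a i p] assms p by auto
  qed
  then show ?thesis using self_in_class_on[OF assms(3)] by auto
qed

section \<open>Elimination of one index\<close>

text \<open>The result of eliminating \<open>k\<close>, to be read on the indices other than \<open>k\<close>. If the pivot is zero,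
  then the quotient is zero and the function is unchanged.\<close>
definition schur :: "'v \<Rightarrow> ('v \<Rightarrow> 'v \<Rightarrow> real) \<Rightarrow> 'v \<Rightarrow> 'v \<Rightarrow> real" where
  "schur k a i j = a i j - a i k * a k j / a k k"

text \<open>The pivot is nonzero, or nothing needs to be eliminated: the products vanish iff column \<open>k\<close>
  or row \<open>k\<close> is zero off the diagonal.\<close>
definition eliminable :: "'v set \<Rightarrow> 'v \<Rightarrow> ('v \<Rightarrow> 'v \<Rightarrow> real) \<Rightarrow> bool" where
  "eliminable I k a \<longleftrightarrow> a k k \<noteq> 0 \<or> (\<forall>i\<in>I-{k}. \<forall>j\<in>I-{k}. a i k * a k j = 0)"

lemma schur_row_sum:
  assumes "finite I" "k \<in> I" "a k k \<noteq> 0"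
  shows "(\<Sum>j\<in>I-{k}. schur k a i j * x j)
    = (\<Sum>j\<in>I. a i j * x j) - a i k / a k k * (\<Sum>j\<in>I. a k j * x j)"
proof -
  have s: "(\<Sum>j\<in>I. a i j * x j) = a i k * x k + (\<Sum>j\<in>I-{k}. a i j * x j)" for i
    using assms by (simp add: sum.remove)
  have "(\<Sum>j\<in>I-{k}. schur k a i j * x j)
     = (\<Sum>j\<in>I-{k}. a i j * x j) - a i k / a k k * (\<Sum>j\<in>I-{k}. a k j * x j)"
    by (simp add: schur_def sum_distrib_left sum_subtractf[symmetric] algebra_simps)
  then show ?thesis unfolding s using assms(3) by (simp add: field_simps)
qed

lemma schur_off_diag:
  assumes "Z_on I a" "k \<in> I" "0 \<le> a k k" "i \<in> I - {k}" "j \<in> I - {k}"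
  shows "schur k a i j \<le> a i j"
proof -
  have "a i k \<le> 0" "a k j \<le> 0" using assms by (auto intro: Z_onD)
  then have "0 \<le> a i k * a k j / a k k" using assms(3) by (intro divide_nonneg_nonneg mult_nonpos_nonpos)
  then show ?thesis by (simp add: schur_def)
qed

lemma Z_on_schur:
  assumes "Z_on I a" "k \<in> I" "0 \<le> a k k"
  shows "Z_on (I - {k}) (schur k a)"
  unfolding Z_on_def
proof (intro ballI impI)
  fix i j assume "i \<in> I - {k}" "j \<in> I - {k}" "i \<noteq> j"
  then show "schur k a i j \<le> 0"
    using schur_off_diag[OF assms, of i j] Z_onD[OF assms(1), of i j] by auto
qed

text \<open>A vector for the eliminated matrix is extended to \<open>k\<close> so that its
  image has a small positive entry \<open>\<delta>\<close> at \<open>k\<close>.\<close>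
lemma semipos_on_schur:
  assumes "finite I" "Z_on I a" "k \<in> I" "0 < a k k"
  shows "semipos_on (I - {k}) (schur k a) \<longleftrightarrow> semipos_on I a"
proof
  assume "semipos_on I a"
  then obtain x where x: "\<forall>i\<in>I. 0 < x i \<and> 0 < (\<Sum>j\<in>I. a i j * x j)"
    by (auto simp: semipos_on_def)
  show "semipos_on (I - {k}) (schur k a)"
    unfolding semipos_on_def
  proof (intro exI[of _ x] ballI conjI)
    fix i assume i: "i \<in> I - {k}"
    show "0 < x i" using i x by auto
    have "a i k \<le> 0" using i assms by (auto intro: Z_onD)
    then have "a i k / a k k * (\<Sum>j\<in>I. a k j * x j) \<le> 0"
      using x assms by (intro mult_nonpos_nonneg divide_nonpos_pos) (auto intro: less_imp_le)
    moreover have "0 < (\<Sum>j\<in>I. a i j * x j)" using x i by auto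
    ultimately show "0 < (\<Sum>j\<in>I - {k}. schur k a i j * x j)"
      using schur_row_sum[of I k a i x] assms by simp
  qed
next
  assume "semipos_on (I - {k}) (schur k a)"
  then obtain x where x: "\<forall>i\<in>I-{k}. 0 < x i \<and> 0 < (\<Sum>j\<in>I-{k}. schur k a i j * x j)"
    by (auto simp: semipos_on_def)
  define g where "g i = (\<Sum>j\<in>I-{k}. schur k a i j * x j)" for i
  define \<delta> where "\<delta> = Min (insert 1 ((\<lambda>i. g i / (1 - a i k / a k k)) ` (I - {k})))"
  have q: "0 \<le> - (a i k / a k k)" if "i \<in> I - {k}" for i
    using that assms Z_onD[OF assms(2), of i k] by (simp add: divide_nonpos_pos)
  have gp: "0 < g i" if "i \<in> I - {k}" for i
    unfolding g_def using that x by blast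
  have "\<delta> > 0" unfolding \<delta>_def using assms q gp
  proof (subst Min_gr_iff)
    show "\<forall>c\<in>insert 1 ((\<lambda>i. g i / (1 - a i k / a k k)) ` (I - {k})). 0 < c"
    proof
      fix c assume "c \<in> insert 1 ((\<lambda>i. g i / (1 - a i k / a k k)) ` (I - {k}))"
      then consider "c = 1" | i where "i \<in> I - {k}" "c = g i / (1 - a i k / a k k)" by auto
      then show "0 < c"
      proof cases
        case (2 i)
        then show ?thesis using q[of i] gp[of i] by (auto intro: divide_pos_pos)
      qed simp
    qed
  qed (use assms in auto)
  have dle: "\<delta> * (1 - a i k / a k k) \<le> g i" if i: "i \<in> I - {k}" for i
  proof -
    have "\<delta> \<le> g i / (1 - a i k / a k k)" unfolding \<delta>_def using assms i by (intro Min_le) auto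
    then show ?thesis using q[OF i] by (subst (asm) pos_le_divide_eq) auto
  qed
  define xk where "xk = (\<delta> - (\<Sum>j\<in>I-{k}. a k j * x j)) / a k k"
  define x' where "x' = x(k := xk)"
  have s: "(\<Sum>j\<in>I-{k}. b j * x' j) = (\<Sum>j\<in>I-{k}. b j * x j)" for b :: "'a \<Rightarrow> real"
    by (intro sum.cong) (auto simp: x'_def)
  have "(\<Sum>j\<in>I-{k}. a k j * x j) \<le> 0"
    using x assms by (intro sum_nonpos mult_nonpos_nonneg) (auto intro: less_imp_le Z_onD)
  then have "xk > 0" unfolding xk_def using \<open>\<delta> > 0\<close> assms by simp
  have rk: "(\<Sum>j\<in>I. a k j * x' j) = \<delta>"
    using assms by (simp add: sum.remove[of I k] s) (simp add: x'_def xk_def)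
  have ri: "0 < (\<Sum>j\<in>I. a i j * x' j)" if i: "i \<in> I - {k}" for i
  proof -
    have "(\<Sum>j\<in>I. a i j * x' j) = g i + a i k / a k k * \<delta>"
      using schur_row_sum[of I k a i x'] assms by (simp add: s rk g_def)
    moreover have "\<delta> * (1 - a i k / a k k) = \<delta> - a i k / a k k * \<delta>" by (simp add: algebra_simps)
    ultimately show ?thesis using dle[OF i] \<open>\<delta> > 0\<close> by linarith
  qed
  show "semipos_on I a" unfolding semipos_on_def
  proof (intro exI[of _ x'] ballI conjI)
    fix i assume i: "i \<in> I"
    show "0 < x' i" using i x \<open>xk > 0\<close> by (auto simp: x'_def)
    show "0 < (\<Sum>j\<in>I. a i j * x' j)"
      using i ri rk \<open>\<delta> > 0\<close> by (cases "i = k") auto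
  qed
qed

text \<open>The vector for \<open>a\<close> and a smaller \<open>\<eta>\<close> serves the eliminated matrix and \<open>\<epsilon>\<close>. Row \<open>i\<close> bounds
  \<open>- a\<^sub>i\<^sub>k x\<^sub>k\<close> by a multiple of \<open>x\<^sub>i\<close>, which controls the error that row \<open>k\<close> adds to row \<open>i\<close>.\<close>
lemma M_on_schur:
  assumes "finite I" "M_on I a" "k \<in> I"
  shows "M_on (I - {k}) (schur k a)"
proof (cases "a k k = 0")
  case True
  then have "schur k a = a" by (simp add: schur_def fun_eq_iff)
  then show ?thesis using M_on_subset[OF assms(1,2)] by auto
next
  case False
  then have kk: "0 < a k k" using M_on_diag_nonneg[OF assms] by simp
  note Z = M_on_Z[OF assms(2)]
  show ?thesis unfolding M_on_def
  proof (intro conjI allI impI)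
    show "Z_on (I - {k}) (schur k a)" using Z_on_schur[OF Z assms(3)] kk by simp
    fix \<epsilon> :: real assume "0 < \<epsilon>"
    \<comment> \<open>Each \<open>1 + (a i i + 1) / a k k\<close> is at most \<open>K\<close>, since diagonal entries are nonnegative.\<close>
    define K where "K = 1 + ((\<Sum>i\<in>I. a i i) + 1) / a k k"
    have d: "a i i \<le> (\<Sum>i\<in>I. a i i)" if "i \<in> I" for i
      using that assms M_on_diag_nonneg by (intro member_le_sum) auto
    have "K \<ge> 1" unfolding K_def using M_on_diag_nonneg[OF assms(1,2)] kk
      by (simp add: sum_nonneg add_nonneg_nonneg)
    define \<eta> where "\<eta> = min 1 (\<epsilon> / K)"
    have e: "0 < \<eta>" "\<eta> \<le> 1" "\<eta> * K \<le> \<epsilon>"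
      using \<open>0 < \<epsilon>\<close> \<open>K \<ge> 1\<close> by (auto simp: \<eta>_def min_def field_simps)
    obtain x where x: "almost_semipos I a \<eta> x" using e(1) assms by (auto simp: M_on_def)
    have pos: "0 < x t" if "t \<in> I" for t using almost_semiposD(1)[OF x that] .
    have "almost_semipos (I - {k}) (schur k a) \<epsilon> x"
      unfolding almost_semipos_def
    proof (intro ballI conjI)
      fix i assume i: "i \<in> I - {k}"
      show "0 < x i" using i pos by simp
      define r where "r i = (\<Sum>j\<in>I. a i j * x j)" for i
      have ri: "- \<eta> * x i < r i" and rk: "- \<eta> * x k < r k"
        unfolding r_def using almost_semiposD(2)[OF x] i assms(3) by auto
      have q: "0 \<le> - (a i k / a k k)"
        using i assms Z_onD[OF Z, of i k] kk by (simp add: divide_nonpos_pos)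
      have "r i \<le> a i i * x i + a i k * x k"
        unfolding r_def using assms i pos Z by (intro row_sum_le_two) (auto intro: less_imp_le)
      then have "- a i k * x k \<le> (a i i + \<eta>) * x i" using ri by (simp add: algebra_simps)
      also have "\<dots> \<le> ((\<Sum>i\<in>I. a i i) + 1) * x i"
        using d[of i] e pos[of i] i by (intro mult_right_mono) auto
      finally have "- a i k * x k / a k k \<le> ((\<Sum>i\<in>I. a i i) + 1) * x i / a k k"
        using kk by (intro divide_right_mono) auto
      then have "x i + - a i k * x k / a k k \<le> K * x i"
        unfolding K_def by (simp add: algebra_simps add_divide_distrib)
      then have "\<eta> * (x i + - a i k * x k / a k k) \<le> \<eta> * (K * x i)"
        using e(1) by (intro mult_left_mono) auto
      then have "\<eta> * x i + \<eta> * (- a i k * x k / a k k) \<le> \<eta> * (K * x i)"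
        by (simp only: distrib_left)
      also have "\<dots> \<le> \<epsilon> * x i" using e(3) pos[of i] i by (simp add: mult.assoc[symmetric])
      finally have 1: "\<eta> * x i + \<eta> * (- a i k * x k / a k k) \<le> \<epsilon> * x i" .
      have "- (a i k / a k k) * (- \<eta> * x k) \<le> - (a i k / a k k) * r k"
        using q rk by (intro mult_left_mono) auto
      moreover have "- (a i k / a k k) * (- \<eta> * x k) = - (\<eta> * (- a i k * x k / a k k))" by simp
      ultimately have "- (\<eta> * (- a i k * x k / a k k)) \<le> - (a i k / a k k) * r k" by linarith
      then have "- \<epsilon> * x i < r i - a i k / a k k * r k" using 1 ri by simp
      then show "- \<epsilon> * x i < (\<Sum>j\<in>I - {k}. schur k a i j * x j)"
        using schur_row_sum[of I k a i x] assms kk by (simp add: r_def)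
    qed
    then show "\<exists>x. almost_semipos (I - {k}) (schur k a) \<epsilon> x" by blast
  qed
qed

lemma schur_nonzero_iff:
  assumes "Z_on I a" "k \<in> I" "0 \<le> a k k" "eliminable I k a" "i \<in> I - {k}" "j \<in> I - {k}" "i \<noteq> j"
  shows "schur k a i j \<noteq> 0 \<longleftrightarrow> a i j \<noteq> 0 \<or> a i k \<noteq> 0 \<and> a k j \<noteq> 0"
proof -
  have le: "a i k \<le> 0" "a k j \<le> 0" "a i j \<le> 0" using assms by (auto intro: Z_onD)
  then have 1: "0 \<le> a i k * a k j" by (simp add: mult_nonpos_nonpos)
  show ?thesis
  proof (cases "a k k = 0")
    case True
    then have "a i k * a k j = 0" using assms by (auto simp: eliminable_def)
    then show ?thesis using True by (auto simp: schur_def)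
  next
    case False
    then have kk: "a k k > 0" using assms by simp
    then have "0 \<le> a i k * a k j / a k k" "a i k * a k j / a k k = 0 \<longleftrightarrow> a i k = 0 \<or> a k j = 0"
      using 1 by auto
    then show ?thesis using le unfolding schur_def by auto
  qed
qed

text \<open>Passing through \<open>k\<close> becomes a direct edge. The induction also tracks paths that currently stop
  at \<open>k\<close>, by the index from which \<open>k\<close> was entered.\<close>
lemma access_on_schur:
  assumes "Z_on I a" "k \<in> I" "0 \<le> a k k" "eliminable I k a" "i \<in> I - {k}" "j \<in> I - {k}"
  shows "access_on (I - {k}) (schur k a) i j \<longleftrightarrow> access_on I a i j"
proof
  assume "access_on (I - {k}) (schur k a) i j"
  then show "access_on I a i j"
  proof (rule access_on_mono)
    fix p q assume pq: "p \<in> I - {k}" "q \<in> I - {k}" "p \<noteq> q" "schur k a p q \<noteq> 0"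
    then have "a p q \<noteq> 0 \<or> a p k \<noteq> 0 \<and> a k q \<noteq> 0"
      using schur_nonzero_iff[OF assms(1-4)] by blast
    then show "access_on I a p q"
      using pq assms(2) access_on_edge[of p I q a] access_on_trans[of I a p k q] access_on_edge[of p I k a]
        access_on_edge[of k I q a] by auto
  qed
next
  let ?c = "access_on (I - {k}) (schur k a)"
  have edge: "?c p q" if "p \<in> I - {k}" "q \<in> I - {k}" "a p q \<noteq> 0 \<or> a p k \<noteq> 0 \<and> a k q \<noteq> 0" for p q
    using that schur_nonzero_iff[OF assms(1-4), of p q] by (cases "p = q") (auto intro: access_on_edge)
  assume "access_on I a i j"
  then have "(j \<noteq> k \<longrightarrow> ?c i j) \<and> (j = k \<longrightarrow> (\<exists>p\<in>I-{k}. ?c i p \<and> a p k \<noteq> 0))"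
  proof (induction rule: access_on_induct)
    case refl
    then show ?case using assms by auto
  next
    case (step p q)
    show ?case
    proof (cases "p = k")
      case True
      then obtain r where r: "r \<in> I - {k}" "?c i r" "a r k \<noteq> 0" using step by auto
      show ?thesis
      proof (cases "q = k")
        case True
        then show ?thesis using r by auto
      next
        case False
        then have "?c r q" using r step True by (intro edge) auto
        then show ?thesis using access_on_trans[OF r(2)] False by auto
      qed
    next
      case False
      then have p: "?c i p" using step by simp
      show ?thesis
      proof (cases "q = k")
        case True
        then show ?thesis using p step False by auto
      next
        case q: False
        then have "?c p q" using step False by (intro edge) auto
        then show ?thesis using access_on_trans[OF p] q by auto
      qed
    qed
  qed
  then show "?c i j" using assms by simp
qed

lemma class_on_schur:
  assumes "Z_on I a" "k \<in> I" "0 \<le> a k k" "eliminable I k a" "s \<in> I - {k}"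
  shows "class_on (I - {k}) (schur k a) s = class_on I a s - {k}"
  using access_on_schur[OF assms(1-4)] assms(5) by (auto simp: class_on_def)

text \<open>Proper principal submatrices of an irreducible M-matrix are nonsingular. All indices other than
  \<open>k\<close> are eliminated one by one; irreducibility is preserved and keeps the pivots positive.\<close>
lemma irreducible_proper_semipos:
  assumes "finite S" "M_on S a" "\<And>i j. i \<in> S \<Longrightarrow> j \<in> S \<Longrightarrow> access_on S a i j" "k \<in> S"
  shows "semipos_on (S - {k}) a"
  using assms
proof (induction "card S" arbitrary: S a rule: less_induct)
  case less
  show ?case
  proof (cases "S = {k}")
    case True
    then show ?thesis by (simp add: semipos_on_def)
  next
    case False
    then obtain i where i: "i \<in> S" "i \<noteq> k" using less.prems by blast
    note Z = M_on_Z[OF less.prems(2)]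
    have "class_on S a i = S" using less.prems i by (auto simp: class_on_def)
    then have "a i i \<noteq> 0" using class_on_zero_diag[OF less.prems(1,2) i(1)] less.prems(4) i by auto
    then have ii: "0 < a i i" using M_on_diag_nonneg[OF less.prems(1,2) i(1)] by simp
    have "semipos_on (S - {i} - {k}) (schur i a)"
    proof (rule less.hyps)
      show "card (S - {i}) < card S" using less.prems(1) i(1) by (rule card_Diff1_less)
      show "M_on (S - {i}) (schur i a)" using less.prems(1,2) i(1) by (rule M_on_schur)
      show "access_on (S - {i}) (schur i a) p q" if "p \<in> S - {i}" "q \<in> S - {i}" for p q
        using access_on_schur[OF Z i(1) _ _ that] ii less.prems(3) that by (auto simp: eliminable_def)
    qed (use less.prems i in auto)
    moreover have "S - {i} - {k} = S - {k} - {i}" by auto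
    ultimately show ?thesis
      using semipos_on_schur[of "S - {k}" a i] less.prems i ii Z_on_subset[OF Z, of "S - {k}"]
      by auto
  qed
qed

section \<open>One-sided singular classes\<close>

text \<open>Each singular class, addressed by its greatest index \<open>s\<close>, has no later index with access to it or
  no later index accessed from it. Failure of semipositivity expresses that the class is singular.\<close>
definition one_sided :: "'v::linorder set \<Rightarrow> ('v \<Rightarrow> 'v \<Rightarrow> real) \<Rightarrow> bool" where
  "one_sided I a \<longleftrightarrow> (\<forall>s\<in>I. (\<forall>t\<in>class_on I a s. t \<le> s) \<and> \<not> semipos_on (class_on I a s) a \<longrightarrow>
     (\<forall>j\<in>I. s < j \<longrightarrow> \<not> access_on I a j s) \<or> (\<forall>j\<in>I. s < j \<longrightarrow> \<not> access_on I a s j))"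

lemma eliminable_zero_pivot:
  assumes "k \<in> I" "a k k = 0" "eliminable I k a"
  shows "(\<forall>j\<in>I-{k}. \<not> access_on I a j k) \<or> (\<forall>j\<in>I-{k}. \<not> access_on I a k j)"
proof -
  have "(\<forall>i\<in>I-{k}. a i k = 0) \<or> (\<forall>j\<in>I-{k}. a k j = 0)"
    using assms by (auto simp: eliminable_def)
  then show ?thesis
  proof
    assume z: "\<forall>i\<in>I-{k}. a i k = 0"
    have "\<not> access_on I a j k" if "j \<in> I - {k}" for j
    proof
      assume "access_on I a j k"
      moreover have "j \<noteq> k" using that by simp
      ultimately obtain p where "p \<in> I" "a p k \<noteq> 0" by (rule access_on_last_edge)
      then show False using z assms by (cases "p = k") auto
    qed
    then show ?thesis by blast
  next
    assume z: "\<forall>j\<in>I-{k}. a k j = 0"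
    have "\<not> access_on I a k j" if "j \<in> I - {k}" for j
    proof
      assume "access_on I a k j"
      moreover have "k \<noteq> j" using that by auto
      ultimately obtain p where "p \<in> I" "a k p \<noteq> 0" by (rule access_on_first_edge)
      then show False using z assms by (cases "p = k") auto
    qed
    then show ?thesis by blast
  qed
qed

text \<open>If \<open>k\<close> lies outside the class of \<open>s\<close>, then elimination does not touch the class, since otherwise a
  path through \<open>k\<close> would put \<open>k\<close> into it.\<close>
lemma semipos_on_class_schur:
  assumes "finite I" "M_on I a" "k \<in> I" "eliminable I k a" "s \<in> I - {k}"
  shows "semipos_on (class_on (I - {k}) (schur k a) s) (schur k a) \<longleftrightarrow> semipos_on (class_on I a s) a"
proof -
  note Z = M_on_Z[OF assms(2)] and nn = M_on_diag_nonneg[OF assms(1-3)]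
  have sub: "class_on I a s \<subseteq> I" by (auto simp: class_on_def)
  note c = class_on_schur[OF Z assms(3) nn assms(4,5)]
  show ?thesis
  proof (cases "k \<in> class_on I a s")
    case True
    then have "s \<in> class_on I a k" using assms(5) by (auto simp: class_on_def)
    then have "a k k \<noteq> 0" using class_on_zero_diag[OF assms(1-3)] assms(5) by auto
    then show ?thesis unfolding c using nn True
      by (intro semipos_on_schur) (auto intro: finite_subset[OF sub assms(1)] Z_on_subset[OF Z sub])
  next
    case False
    have "schur k a i j = a i j" if "i \<in> class_on I a s" "j \<in> class_on I a s" for i j
    proof -
      have "a i k = 0 \<or> a k j = 0"
      proof (rule ccontr)
        assume "\<not> ?thesis"
        then have "access_on I a i k" "access_on I a k j" using that sub assms(3) by (auto intro!: access_on_edge)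
        then have "k \<in> class_on I a s" using that assms(3) unfolding class_on_def by (blast intro: access_on_trans)
        then show False using False by simp
      qed
      then show ?thesis by (auto simp: schur_def)
    qed
    then show ?thesis unfolding c using False semipos_on_cong[of "class_on I a s" "schur k a" a] by simp
  qed
qed

lemma one_sided_schur:
  assumes "finite I" "M_on I a" "k \<in> I" "\<And>i. i \<in> I \<Longrightarrow> k \<le> i" "eliminable I k a"
  shows "one_sided I a \<longleftrightarrow> one_sided (I - {k}) (schur k a)"
proof -
  define Q where "Q I a s \<longleftrightarrow> ((\<forall>t\<in>class_on I a s. t \<le> s) \<and> \<not> semipos_on (class_on I a s) a \<longrightarrow>
     (\<forall>j\<in>I. s < j \<longrightarrow> \<not> access_on I a j s) \<or> (\<forall>j\<in>I. s < j \<longrightarrow> \<not> access_on I a s j))"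
    for I and a :: "'a \<Rightarrow> 'a \<Rightarrow> real" and s
  note Z = M_on_Z[OF assms(2)] and nn = M_on_diag_nonneg[OF assms(1-3)]
  have rest: "Q (I - {k}) (schur k a) s \<longleftrightarrow> Q I a s" if s: "s \<in> I - {k}" for s
  proof -
    have "k < s" using s assms(4)[of s] by auto
    have 1: "(\<forall>t\<in>class_on (I - {k}) (schur k a) s. t \<le> s) \<longleftrightarrow> (\<forall>t\<in>class_on I a s. t \<le> s)"
      using \<open>k < s\<close> unfolding class_on_schur[OF Z assms(3) nn assms(5) s] by auto
    have 2: "(\<forall>j\<in>I-{k}. s < j \<longrightarrow> \<not> access_on (I - {k}) (schur k a) j s) \<longleftrightarrow> (\<forall>j\<in>I. s < j \<longrightarrow> \<not> access_on I a j s)"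
      using \<open>k < s\<close> access_on_schur[OF Z assms(3) nn assms(5) _ s] by auto
    have 3: "(\<forall>j\<in>I-{k}. s < j \<longrightarrow> \<not> access_on (I - {k}) (schur k a) s j) \<longleftrightarrow> (\<forall>j\<in>I. s < j \<longrightarrow> \<not> access_on I a s j)"
      using \<open>k < s\<close> access_on_schur[OF Z assms(3) nn assms(5) s] by auto
    show ?thesis unfolding Q_def 1 2 3 semipos_on_class_schur[OF assms(1-3,5) s] ..
  qed
  have "Q I a k"
    unfolding Q_def
  proof
    assume h: "(\<forall>t\<in>class_on I a k. t \<le> k) \<and> \<not> semipos_on (class_on I a k) a"
    have "t = k" if "t \<in> class_on I a k" for t
      using h that assms(4)[of t] by (auto simp: class_on_def intro: antisym)
    then have "class_on I a k = {k}" using self_in_class_on[OF assms(3)] by blast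
    then have "a k k = 0" using h nn by (auto simp: semipos_on_singleton)
    then show "(\<forall>j\<in>I. k < j \<longrightarrow> \<not> access_on I a j k) \<or> (\<forall>j\<in>I. k < j \<longrightarrow> \<not> access_on I a k j)"
      using eliminable_zero_pivot[of k I a] assms by auto
  qed
  have "(\<forall>s\<in>I. Q I a s) \<longleftrightarrow> (\<forall>s\<in>I-{k}. Q (I - {k}) (schur k a) s)"
    using rest \<open>Q I a k\<close> by (metis Diff_iff singletonD)
  then show ?thesis unfolding one_sided_def Q_def .
qed

lemma one_sided_pivot_eliminable:
  assumes "finite I" "M_on I a" "k \<in> I" "\<And>i. i \<in> I \<Longrightarrow> k \<le> i" "one_sided I a"
  shows "eliminable I k a"
proof (cases "a k k = 0")
  case True
  have c: "class_on I a k = {k}" using class_on_zero_diag[OF assms(1-3) True] .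
  then have "(\<forall>j\<in>I. k < j \<longrightarrow> \<not> access_on I a j k) \<or> (\<forall>j\<in>I. k < j \<longrightarrow> \<not> access_on I a k j)"
    using assms(3,5) True by (auto simp: one_sided_def semipos_on_singleton)
  moreover have "k < j" if "j \<in> I - {k}" for j using that assms(4)[of j] by auto
  ultimately have "(\<forall>j\<in>I-{k}. a j k = 0) \<or> (\<forall>j\<in>I-{k}. a k j = 0)"
    using access_on_edge[of _ I k a] access_on_edge[of k I _ a] assms(3) by blast
  then show ?thesis by (auto simp: eliminable_def)
qed (simp add: eliminable_def)

text \<open>Lowering entries only adds access. A singular class of \<open>a\<close> lies in a class of \<open>b\<close>; it stays singular
  for \<open>b\<close> and therefore cannot be a proper part of that class.\<close>
lemma one_sided_mono:
  assumes "finite I" "M_on I b" "Z_on I a" "\<And>i j. i \<in> I \<Longrightarrow> j \<in> I \<Longrightarrow> b i j \<le> a i j" "one_sided I b"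
  shows "one_sided I a"
  unfolding one_sided_def
proof (intro ballI impI)
  have access_on: "access_on I b i j" if "access_on I a i j" for i j
    using that
  proof (rule access_on_mono)
    fix p q assume "p \<in> I" "q \<in> I" "p \<noteq> q" "a p q \<noteq> 0"
    then show "access_on I b p q" using assms(4)[of p q] Z_onD[OF assms(3), of p q] by (intro access_on_edge) auto
  qed
  fix s assume s: "s \<in> I" and h: "(\<forall>t\<in>class_on I a s. t \<le> s) \<and> \<not> semipos_on (class_on I a s) a"
  have sub: "class_on I a s \<subseteq> class_on I b s" "class_on I b s \<subseteq> I" using access_on by (auto simp: class_on_def)
  have fin: "finite (class_on I b s)" using sub(2) assms(1) finite_subset by blast
  have nb: "\<not> semipos_on (class_on I a s) b"
    using h semipos_on_mono[of "class_on I a s" b a] assms(4) sub by blast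
  have Mb: "M_on (class_on I b s) b" using M_on_subset[OF assms(1,2) sub(2)] .
  have "class_on I b s \<subseteq> class_on I a s"
  proof
    fix k assume k: "k \<in> class_on I b s"
    show "k \<in> class_on I a s"
    proof (rule ccontr)
      assume "k \<notin> class_on I a s"
      have "semipos_on (class_on I b s - {k}) b"
      proof (rule irreducible_proper_semipos[OF fin Mb _ k])
        fix i j assume ij: "i \<in> class_on I b s" "j \<in> class_on I b s"
        then have "access_on I b i j" unfolding class_on_def by (blast intro: access_on_trans)
        then show "access_on (class_on I b s) b i j" using ij by (rule access_on_within_class)
      qed
      moreover have "class_on I a s \<subseteq> class_on I b s - {k}" using sub \<open>k \<notin> class_on I a s\<close> by auto
      ultimately show False
        using nb semipos_on_subset[of "class_on I b s - {k}" b "class_on I a s"] fin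
          Z_on_subset[OF M_on_Z[OF Mb], of "class_on I b s - {k}"] by auto
    qed
  qed
  then have eq: "class_on I b s = class_on I a s" using sub by auto
  have "(\<forall>j\<in>I. s < j \<longrightarrow> \<not> access_on I b j s) \<or> (\<forall>j\<in>I. s < j \<longrightarrow> \<not> access_on I b s j)"
    using assms(5) s h nb unfolding one_sided_def eq[symmetric] by blast
  then show "(\<forall>j\<in>I. s < j \<longrightarrow> \<not> access_on I a j s) \<or> (\<forall>j\<in>I. s < j \<longrightarrow> \<not> access_on I a s j)"
    using access_on by blast
qed

section \<open>Triangular factors\<close>

text \<open>Lower triangular M-matrices: for triangular matrices the spectral condition reduces to a
  nonnegative diagonal, see \<open>triangular_M_on\<close>.\<close>
definition lower_on :: "'v::linorder set \<Rightarrow> ('v \<Rightarrow> 'v \<Rightarrow> real) \<Rightarrow> bool" where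
  "lower_on I l \<longleftrightarrow> Z_on I l \<and> (\<forall>i\<in>I. 0 \<le> l i i) \<and> (\<forall>i\<in>I. \<forall>j\<in>I. i < j \<longrightarrow> l i j = 0)"

text \<open>Upper triangular M-matrices, with the analogous condition.\<close>
definition upper_on :: "'v::linorder set \<Rightarrow> ('v \<Rightarrow> 'v \<Rightarrow> real) \<Rightarrow> bool" where
  "upper_on I u \<longleftrightarrow> Z_on I u \<and> (\<forall>i\<in>I. 0 \<le> u i i) \<and> (\<forall>i\<in>I. \<forall>j\<in>I. j < i \<longrightarrow> u i j = 0)"

text \<open>One step of substitution in a triangular system; \<open>k\<close> is the unknown that is solved for last.\<close>
lemma extend_solution:
  assumes "finite I" "k \<notin> I" "0 < a k k" "Z_on (insert k I) a" "\<And>i. i \<in> I \<Longrightarrow> a i k = 0" "0 < f k"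
    and x: "\<And>i. i \<in> I \<Longrightarrow> 0 < x i \<and> (\<Sum>j\<in>I. a i j * x j) = f i"
  shows "\<exists>x. \<forall>i\<in>insert k I. 0 < x i \<and> (\<Sum>j\<in>insert k I. a i j * x j) = f i"
proof -
  define xk where "xk = (f k - (\<Sum>j\<in>I. a k j * x j)) / a k k"
  define x' where "x' = x(k := xk)"
  have s: "(\<Sum>j\<in>I. b j * x' j) = (\<Sum>j\<in>I. b j * x j)" for b :: "'a \<Rightarrow> real"
    using assms(2) by (intro sum.cong) (auto simp: x'_def)
  have "(\<Sum>j\<in>I. a k j * x j) \<le> 0"
  proof (intro sum_nonpos mult_nonpos_nonneg)
    fix j assume "j \<in> I"
    then show "a k j \<le> 0" "0 \<le> x j"
      using assms(2) x[of j] Z_onD[OF assms(4), of k j] by auto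
  qed
  then have "xk > 0" unfolding xk_def using assms by (intro divide_pos_pos) auto
  show ?thesis
  proof (intro exI[of _ x'] ballI conjI)
    fix i assume i: "i \<in> insert k I"
    show "0 < x' i" using i x \<open>xk > 0\<close> by (auto simp: x'_def)
    show "(\<Sum>j\<in>insert k I. a i j * x' j) = f i"
    proof (cases "i = k")
      case True
      have "a k k * x' k = f k - (\<Sum>j\<in>I. a k j * x j)" using assms(3) by (simp add: x'_def xk_def)
      then show ?thesis using assms(1,2) True by (simp add: s)
    next
      case False
      then have "i \<in> I" using i by simp
      then show ?thesis using assms(1,2,5) x by (simp add: s)
    qed
  qed
qed

lemma lower_solution:
  assumes "finite I" "lower_on I l" "\<And>i. i \<in> I \<Longrightarrow> 0 < l i i" "\<And>i. i \<in> I \<Longrightarrow> 0 < f i"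
  shows "\<exists>x. \<forall>i\<in>I. 0 < x i \<and> (\<Sum>j\<in>I. l i j * x j) = f i"
  using assms
proof (induction I rule: finite_linorder_max_induct)
  case empty
  then show ?case by simp
next
  case (insert k I)
  have "lower_on I l" using insert.prems(1) unfolding lower_on_def Z_on_def by blast
  then obtain x where "\<forall>i\<in>I. 0 < x i \<and> (\<Sum>j\<in>I. l i j * x j) = f i"
    using insert.IH insert.prems by auto
  then show ?case
    using insert by (intro extend_solution[of I k l f x]) (auto simp: lower_on_def)
qed

lemma upper_solution:
  assumes "finite I" "upper_on I u" "\<And>i. i \<in> I \<Longrightarrow> 0 < u i i" "\<And>i. i \<in> I \<Longrightarrow> 0 < f i"
  shows "\<exists>x. \<forall>i\<in>I. 0 < x i \<and> (\<Sum>j\<in>I. u i j * x j) = f i"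
  using assms
proof (induction I rule: finite_linorder_min_induct)
  case empty
  then show ?case by simp
next
  case (insert k I)
  have "upper_on I u" using insert.prems(1) unfolding upper_on_def Z_on_def by blast
  then obtain x where "\<forall>i\<in>I. 0 < x i \<and> (\<Sum>j\<in>I. u i j * x j) = f i"
    using insert.IH insert.prems by auto
  then show ?case
    using insert by (intro extend_solution[of I k u f x]) (auto simp: upper_on_def)
qed

text \<open>With \<open>(L + \<eta> 1) y = 1\<close> and \<open>(U + \<eta> 1) x = y\<close> one has \<open>x > 0\<close> and
  \<open>L U x = 1 - \<eta> (y + L x)\<close>, and \<open>y + L x\<close> is at most a multiple of \<open>x\<close>.\<close>
lemma M_on_product:
  assumes "finite I" "lower_on I l" "upper_on I u" "Z_on I a"
    and a: "\<And>i j. i \<in> I \<Longrightarrow> j \<in> I \<Longrightarrow> a i j = (\<Sum>p\<in>I. l i p * u p j)"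
  shows "M_on I a"
  unfolding M_on_def
proof (intro conjI allI impI)
  show "Z_on I a" by fact
  have Zl: "Z_on I l" and Zu: "Z_on I u" 
    and dl: "\<And>i. i \<in> I \<Longrightarrow> 0 \<le> l i i" and du: "\<And>i. i \<in> I \<Longrightarrow> 0 \<le> u i i"
    using assms by (auto simp: lower_on_def upper_on_def)
  fix \<epsilon> :: real assume "0 < \<epsilon>"
  define K where "K = 2 + (\<Sum>i\<in>I. l i i + u i i)"
  have K: "2 + (l i i + u i i) \<le> K" if "i \<in> I" for i
    unfolding K_def using that assms(1) dl du
    by (intro add_left_mono member_le_sum) auto
  have "K \<ge> 2" unfolding K_def using dl du by (simp add: sum_nonneg)
  define \<eta> where "\<eta> = min 1 (\<epsilon> / K)"
  have e: "0 < \<eta>" "\<eta> \<le> 1" "\<eta> * K \<le> \<epsilon>"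
    using \<open>0 < \<epsilon>\<close> \<open>K \<ge> 2\<close> by (auto simp: \<eta>_def min_def field_simps)
  define sh where "sh b i j = (if i = j then b i j + \<eta> else b i j)" for b :: "'a \<Rightarrow> 'a \<Rightarrow> real" and i j
  have sh: "(\<Sum>j\<in>I. sh b i j * x j) = (\<Sum>j\<in>I. b i j * x j) + \<eta> * x i" if "i \<in> I" for b i x
    unfolding sh_def using assms(1) that by (rule row_sum_shift)
  have lus: "lower_on I (sh l)" "upper_on I (sh u)"
    using assms(2,3) e(1) by (auto simp: lower_on_def upper_on_def Z_on_def sh_def)
  have lud: "0 < sh l i i" "0 < sh u i i" if "i \<in> I" for i
    using dl[OF that] du[OF that] e(1) by (auto simp: sh_def)
  obtain y where y: "\<And>i. i \<in> I \<Longrightarrow> 0 < y i \<and> (\<Sum>j\<in>I. sh l i j * y j) = 1"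
    using lower_solution[OF assms(1) lus(1) lud(1), of "\<lambda>_. 1"] by auto
  then obtain x where x: "\<And>i. i \<in> I \<Longrightarrow> 0 < x i \<and> (\<Sum>j\<in>I. sh u i j * x j) = y i"
    using upper_solution[OF assms(1) lus(2) lud(2), of y] by blast
  have "almost_semipos I a \<epsilon> x" unfolding almost_semipos_def
  proof (intro ballI conjI)
    fix i assume i: "i \<in> I"
    show "0 < x i" using x i by simp
    have ux: "(\<Sum>j\<in>I. u p j * x j) = y p - \<eta> * x p" if "p \<in> I" for p
      using x[OF that] sh[OF that, of u x] by simp
    have "(\<Sum>j\<in>I. a i j * x j) = (\<Sum>j\<in>I. \<Sum>p\<in>I. l i p * (u p j * x j))"
      using a i by (intro sum.cong) (auto simp: sum_distrib_right mult.assoc)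
    also have "\<dots> = (\<Sum>p\<in>I. l i p * (\<Sum>j\<in>I. u p j * x j))"
      by (subst sum.swap) (simp add: sum_distrib_left)
    also have "\<dots> = (\<Sum>p\<in>I. l i p * (y p - \<eta> * x p))"
      using ux by (intro sum.cong) auto
    also have "\<dots> = (\<Sum>p\<in>I. l i p * y p) - \<eta> * (\<Sum>p\<in>I. l i p * x p)"
      by (simp add: algebra_simps sum_subtractf sum_distrib_left)
    also have "(\<Sum>p\<in>I. l i p * y p) = 1 - \<eta> * y i" using y[OF i] sh[OF i, of l y] by simp
    finally have ax: "(\<Sum>j\<in>I. a i j * x j) = 1 - \<eta> * (y i + (\<Sum>p\<in>I. l i p * x p))"
      by (simp add: algebra_simps)
    have "(\<Sum>p\<in>I. l i p * x p) \<le> l i i * x i"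
      using assms(1) Zl i x by (intro row_sum_le_diag) (auto intro: less_imp_le)
    moreover have "y i \<le> u i i * x i + \<eta> * x i"
      using ux[OF i] row_sum_le_diag[OF assms(1) Zu i, of x] x by (simp add: less_imp_le)
    moreover have "\<eta> * x i \<le> 1 * x i" using e x[OF i] by (intro mult_right_mono) auto
    ultimately have "y i + (\<Sum>p\<in>I. l i p * x p) \<le> (2 + (l i i + u i i)) * x i"
      unfolding distrib_right using x[OF i] by linarith
    also have "\<dots> \<le> K * x i" using K[OF i] x[OF i] by (intro mult_right_mono) auto
    finally have "\<eta> * (y i + (\<Sum>p\<in>I. l i p * x p)) \<le> \<eta> * (K * x i)"
      using e(1) by (intro mult_left_mono) auto
    also have "\<dots> \<le> \<epsilon> * x i" using e(3) x[OF i] by (simp add: mult.assoc[symmetric])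
    finally show "- \<epsilon> * x i < (\<Sum>j\<in>I. a i j * x j)" using ax by simp
  qed
  then show "\<exists>x. almost_semipos I a \<epsilon> x" by blast
qed

text \<open>One factor in \<open>M_on_product\<close> is the identity.\<close>
lemma triangular_M_on:
  shows "finite I \<Longrightarrow> lower_on I l \<Longrightarrow> M_on I l" and "finite I \<Longrightarrow> upper_on I l \<Longrightarrow> M_on I l"
proof -
  let ?id = "\<lambda>i j. if i = j then 1 else 0"
  have id: "lower_on I ?id" "upper_on I ?id" by (auto simp: lower_on_def upper_on_def Z_on_def)
  have l: "(\<Sum>p\<in>I. l i p * ?id p j) = l i j" and u: "(\<Sum>p\<in>I. ?id i p * l p j) = l i j"
    if "i \<in> I" "j \<in> I" "finite I" for i j
    using that by (simp_all add: if_distrib[of "\<lambda>x. _ * x"] if_distrib[of "\<lambda>x. x * _"] cong: if_cong)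
  show "finite I \<Longrightarrow> lower_on I l \<Longrightarrow> M_on I l"
    using id l by (intro M_on_product[of I l ?id]) (auto simp: lower_on_def)
  show "finite I \<Longrightarrow> upper_on I l \<Longrightarrow> M_on I l"
    using id u by (intro M_on_product[of I ?id l]) (auto simp: upper_on_def)
qed

lemma factorization_imp_one_sided:
  assumes "finite I" "lower_on I l" "upper_on I u" "Z_on I a"
    and "\<And>i j. i \<in> I \<Longrightarrow> j \<in> I \<Longrightarrow> a i j = (\<Sum>p\<in>I. l i p * u p j)"
  shows "one_sided I a"
  using assms
proof (induction I arbitrary: a rule: finite_linorder_min_induct)
  case empty
  then show ?case by (simp add: one_sided_def)
next
  case (insert k I)
  let ?I = "insert k I"
  have kI: "k \<notin> I" and II: "?I - {k} = I" using insert.hyps by auto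
  have M: "M_on ?I a" using insert by (intro M_on_product[of ?I l u]) auto
  note nn = M_on_diag_nonneg[OF _ M, of k]
  have kmin: "k \<le> i" if "i \<in> ?I" for i using that insert.hyps by (auto simp: less_imp_le)
  have lk: "l k j = 0" "u j k = 0" if "j \<in> I" for j
    using that insert.prems(1,2) insert.hyps(2) by (auto simp: lower_on_def upper_on_def)
  have kk: "a k k = l k k * u k k" using insert.prems(4)[of k k] insert.hyps(1) kI lk by simp
  have ik: "a i k = l i k * u k k" if "i \<in> I" for i
    using insert.prems(4)[of i k] that insert.hyps(1) kI lk by simp
  have kj: "a k j = l k k * u k j" if "j \<in> I" for j
    using insert.prems(4)[of k j] that insert.hyps(1) kI lk by simp
  have elim: "eliminable ?I k a"
    unfolding eliminable_def II using kk ik kj by auto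
  define b where "b i j = (\<Sum>p\<in>I. l i p * u p j)" for i j
  have ab: "a i j = l i k * u k j + b i j" if "i \<in> I" "j \<in> I" for i j
    using insert.prems(4)[of i j] that insert.hyps(1) kI by (simp add: b_def)
  have lu: "0 \<le> l i k * u k j" if "i \<in> I" "j \<in> I" for i j
    using that insert.prems(1,2) kI by (intro mult_nonpos_nonpos) (auto simp: lower_on_def upper_on_def intro: Z_onD)
  have Zb: "Z_on I b" unfolding Z_on_def
  proof (intro ballI impI)
    fix i j assume "i \<in> I" "j \<in> I" "i \<noteq> j"
    then show "b i j \<le> 0" using ab[of i j] lu[of i j] Z_onD[OF insert.prems(3), of i j] by simp
  qed
  have l: "lower_on I l" and u: "upper_on I u"
    using insert.prems(1,2) by (auto simp: lower_on_def upper_on_def Z_on_def)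
  have le: "b i j \<le> schur k a i j" if "i \<in> I" "j \<in> I" for i j
  proof (cases "a k k = 0")
    case True
    then show ?thesis using ab[OF that] lu[OF that] by (simp add: schur_def)
  next
    case False
    then have "a i k * a k j / a k k = l i k * u k j"
      using that by (simp add: ik kj kk)
    then show ?thesis using ab[OF that] by (simp add: schur_def)
  qed
  have "M_on I b" using insert.hyps(1) l u Zb by (rule M_on_product) (simp add: b_def)
  moreover have "one_sided I b" using l u Zb by (rule insert.IH) (simp add: b_def)
  moreover have "Z_on I (schur k a)" using Z_on_schur[OF insert.prems(3), of k] nn insert.hyps(1) II by simp
  ultimately have "one_sided I (schur k a)"
    using insert.hyps(1) le by (intro one_sided_mono[of I b "schur k a"]) auto
  then show ?case
    using one_sided_schur[OF _ M _ kmin elim] insert.hyps(1) II by simp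
qed

lemma one_sided_imp_factorization:
  assumes "finite I" "M_on I a" "one_sided I a"
  shows "\<exists>l u. lower_on I l \<and> upper_on I u \<and> (\<forall>i\<in>I. \<forall>j\<in>I. a i j = (\<Sum>p\<in>I. l i p * u p j))"
  using assms
proof (induction I arbitrary: a rule: finite_linorder_min_induct)
  case empty
  then show ?case by (auto simp: lower_on_def upper_on_def Z_on_def)
next
  case (insert k I)
  let ?I = "insert k I"
  have kI: "k \<notin> I" and II: "?I - {k} = I" and fin: "finite ?I" using insert.hyps by auto
  have kmin: "k \<le> i" if "i \<in> ?I" for i using that insert.hyps by (auto simp: less_imp_le)
  note M = insert.prems(1)
  note Z = M_on_Z[OF M]
  have nn: "0 \<le> a k k" using M_on_diag_nonneg[OF fin M] by simp
  have elim: "eliminable ?I k a"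
    using one_sided_pivot_eliminable[OF fin M _ _ insert.prems(2)] kmin by blast
  have "M_on I (schur k a)" using M_on_schur[OF fin M, of k] II by simp
  moreover have "one_sided I (schur k a)"
    using one_sided_schur[OF fin M _ _ elim] kmin insert.prems(2) II by auto
  ultimately obtain l u where l: "lower_on I l" and u: "upper_on I u"
    and lu: "\<And>i j. i \<in> I \<Longrightarrow> j \<in> I \<Longrightarrow> schur k a i j = (\<Sum>p\<in>I. l i p * u p j)"
    using insert.IH by blast
  \<comment> \<open>The first column of \<open>L\<close> and the first row of \<open>U\<close>. For a zero pivot, one of the two diagonal
    entries is 1 and the other one is 0.\<close>
  have "\<exists>lk uk. 0 \<le> lk k \<and> 0 \<le> uk k \<and> (\<forall>i\<in>I. lk i \<le> 0 \<and> uk i \<le> 0) \<and> a k k = lk k * uk k \<and>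
    (\<forall>i\<in>I. a i k = lk i * uk k \<and> a k i = lk k * uk i \<and> (\<forall>j\<in>I. a i k * a k j / a k k = lk i * uk j))"
  proof -
    have Zk: "a i k \<le> 0" "a k i \<le> 0" if "i \<in> I" for i
      using that kI Z_onD[OF Z, of i k] Z_onD[OF Z, of k i] by auto
    consider "0 < a k k" | "a k k = 0" "\<forall>i\<in>I. a i k = 0" | "a k k = 0" "\<forall>i\<in>I. a k i = 0"
      using nn elim unfolding eliminable_def II by force
    then show ?thesis
    proof cases
      case 1
      then show ?thesis using Zk kI
        by (intro exI[of _ "\<lambda>i. a i k / a k k"] exI[of _ "\<lambda>j. a k j"]) (auto simp: divide_nonpos_pos)
    next
      case 2
      then show ?thesis using Zk kI
        by (intro exI[of _ "\<lambda>i. if i = k then 1 else 0"] exI[of _ "\<lambda>j. a k j"]) auto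
    next
      case 3
      then show ?thesis using Zk kI
        by (intro exI[of _ "\<lambda>i. a i k"] exI[of _ "\<lambda>j. if j = k then 1 else 0"]) auto
    qed
  qed
  then obtain lk uk where kk: "0 \<le> lk k" "0 \<le> uk k" "a k k = lk k * uk k"
    and ki: "\<And>i. i \<in> I \<Longrightarrow> lk i \<le> 0 \<and> uk i \<le> 0 \<and> a i k = lk i * uk k \<and> a k i = lk k * uk i"
    and kij: "\<And>i j. i \<in> I \<Longrightarrow> j \<in> I \<Longrightarrow> a i k * a k j / a k k = lk i * uk j"
    by blast
  define l' where "l' i j = (if j = k then lk i else if i = k then 0 else l i j)" for i j
  define u' where "u' i j = (if i = k then uk j else if j = k then 0 else u i j)" for i j
  have kless: "k < i" if "i \<in> I" for i using that insert.hyps by auto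
  have ne: "i \<noteq> k" if "i \<in> I" for i using that kI by auto
  have "lower_on ?I l'"
    using l kk ki kless ne unfolding lower_on_def Z_on_def l'_def
    by (auto dest: less_asym)
  moreover have "upper_on ?I u'"
    using u kk ki kless ne unfolding upper_on_def Z_on_def u'_def
    by (auto dest: less_asym)
  moreover have "a i j = (\<Sum>p\<in>?I. l' i p * u' p j)" if ij: "i \<in> ?I" "j \<in> ?I" for i j
  proof -
    have 1: "(\<Sum>p\<in>?I. l' i p * u' p j) = lk i * uk j + (\<Sum>p\<in>I. l' i p * u' p j)"
      using insert.hyps(1) kI by (simp add: l'_def u'_def)
    have 2: "(\<Sum>p\<in>I. l' i p * u' p j) = (if i = k \<or> j = k then 0 else (\<Sum>p\<in>I. l i p * u p j))"
      using ne by (auto simp: l'_def u'_def intro!: sum.neutral sum.cong)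
    consider "i = k" "j = k" | "i = k" "j \<in> I" | "i \<in> I" "j = k" | "i \<in> I" "j \<in> I" using ij by blast
    then show ?thesis
    proof cases
      case 4
      then have "a i j = lk i * uk j + schur k a i j" using kij[of i j] by (simp add: schur_def)
      then show ?thesis unfolding 1 2 using 4 lu ne by auto
    qed (use kk ki 1 2 in auto)
  qed
  ultimately show ?case by blast
qed

section \<open>The spectral radius of a nonnegative matrix\<close>

lemma pow_mat_Suc_left:
  assumes "A \<in> carrier_mat n n"
  shows "A ^\<^sub>m Suc k = A * A ^\<^sub>m k"
proof (induction k)
  case 0
  then show ?case using assms by simp
next
  case (Suc k)
  have "A ^\<^sub>m Suc (Suc k) = (A * A ^\<^sub>m k) * A" by (simp only: pow_mat.simps(2)[of A "Suc k"] Suc)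
  also have "\<dots> = A * A ^\<^sub>m Suc k"
    using assms assoc_mult_mat[OF assms pow_carrier_mat[OF assms] assms] by simp
  finally show ?case .
qed

lemma mat_vec_entry:
  assumes "A \<in> carrier_mat n n" "v \<in> carrier_vec n" "i < n"
  shows "(A *\<^sub>v v) $ i = (\<Sum>j<n. A $$ (i, j) * v $ j)"
  using assms by (simp add: scalar_prod_def atLeast0LessThan)

lemma spectral_radius_nonneg:
  assumes "C \<in> carrier_mat n n" "0 < n"
  shows "0 \<le> spectral_radius C"
  using spectral_radius_mem_max(1)[OF assms] by auto

lemma spectral_radius_scaled_less_one:
  assumes C: "C \<in> carrier_mat n n" and n: "0 < n" and "spectral_radius C < b"
  shows "spectral_radius (complex_of_real (1 / b) \<cdot>\<^sub>m C) < 1"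
proof -
  have b: "0 < b" using spectral_radius_nonneg[OF C n] assms(3) by linarith
  let ?Q = "complex_of_real (1 / b) \<cdot>\<^sub>m C"
  have Q: "?Q \<in> carrier_mat n n" using C by simp
  obtain z v where z: "norm z = spectral_radius ?Q" and v: "eigenvector ?Q v z"
    using spectral_radius_mem_max(1)[OF Q n] by (auto simp: spectrum_def eigenvalue_def)
  have "eigenvector C v (of_real b * z)" 
    unfolding eigenvector_def
  proof (intro conjI)
    show vc: "v \<in> carrier_vec (dim_row C)" "v \<noteq> 0\<^sub>v (dim_row C)" using v by (auto simp: eigenvector_def)
    have vn: "v \<in> carrier_vec n" using vc C by simp
    show "C *\<^sub>v v = (of_real b * z) \<cdot>\<^sub>v v"
    proof (rule eq_vecI)
      fix i assume "i < dim_vec ((of_real b * z) \<cdot>\<^sub>v v)"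
      then have i: "i < n" using vn by simp
      have "(?Q *\<^sub>v v) $ i = complex_of_real (1 / b) * (C *\<^sub>v v) $ i"
        unfolding mat_vec_entry[OF Q vn i] mat_vec_entry[OF C vn i] using C i
        by (simp add: sum_distrib_left)
      moreover have "(?Q *\<^sub>v v) $ i = z * v $ i"
        using v vn i by (simp add: eigenvector_def)
      ultimately show "(C *\<^sub>v v) $ i = ((of_real b * z) \<cdot>\<^sub>v v) $ i"
        using b vn i by (simp add: field_simps)
    qed (use C vn in auto)
  qed
  then have "norm (of_real b * z) \<le> spectral_radius C"
    by (intro spectral_radius_mem_max(2)[OF C n] imageI) (auto simp: spectrum_def eigenvalue_def)
  then have le: "b * spectral_radius ?Q \<le> spectral_radius C"
    using b by (simp add: norm_mult z)
  show ?thesis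
  proof (rule ccontr)
    assume "\<not> spectral_radius ?Q < 1"
    then have "b * 1 \<le> b * spectral_radius ?Q" using b by (intro mult_left_mono) auto
    with le assms(3) show False by simp
  qed
qed

text \<open>For \<open>b\<close> strictly between the spectral radius and \<open>\<beta>\<close>, the powers of \<open>R = P / b\<close> are bounded. The
  vector is a partial sum of the Neumann series of the inverse of \<open>\<beta> 1 - P\<close> applied to
  the all-ones vector, up to a factor, with \<open>K\<close> so large that the remainder is less than one.\<close>
lemma spectral_radius_less_imp_subinvariant:
  assumes P: "P \<in> carrier_mat n n" and nn: "\<And>i j. i < n \<Longrightarrow> j < n \<Longrightarrow> 0 \<le> P $$ (i, j)"
    and sr: "spectral_radius (map_mat complex_of_real P) < \<beta>"
  shows "\<exists>x. \<forall>i<n. 0 < x i \<and> (\<Sum>j<n. P $$ (i, j) * x j) < \<beta> * x i"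
proof (cases "n = 0")
  case False
  then have n: "0 < n" by simp
  let ?C = "map_mat complex_of_real P"
  have C: "?C \<in> carrier_mat n n" using P by simp
  define b where "b = (spectral_radius ?C + \<beta>) / 2"
  have b: "spectral_radius ?C < b" "b < \<beta>" "0 < b"
    using sr spectral_radius_nonneg[OF C n] by (auto simp: b_def)
  define R where "R = (1 / b) \<cdot>\<^sub>m P"
  have R: "R \<in> carrier_mat n n" using P by (simp add: R_def)
  have RC: "map_mat complex_of_real R = complex_of_real (1 / b) \<cdot>\<^sub>m ?C"
    using P by (auto simp: R_def)
  have "map_mat complex_of_real R \<in> carrier_mat n n" using R by simp
  moreover have "spectral_radius (map_mat complex_of_real R) < 1"
    unfolding RC by (rule spectral_radius_scaled_less_one[OF C n b(1)])
  ultimately obtain c where c: "\<And>k. norm_bound (map_mat complex_of_real R ^\<^sub>m k) c"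
    using spectral_radius_jnf_norm_bound_less_1_upper_triangular by blast
  have c': "(R ^\<^sub>m k) $$ (i, j) \<le> c" if "i < n" "j < n" for k i j
  proof -
    have "norm ((map_mat complex_of_real R ^\<^sub>m k) $$ (i, j)) \<le> c"
      using c[of k] that R by (simp add: norm_bound_def)
    then show ?thesis using that R by (simp add: of_real_hom.mat_hom_pow[OF R, symmetric])
  qed
  define w where "w k i = (\<Sum>j<n. (R ^\<^sub>m k) $$ (i, j))" for k i
  have w0: "w 0 i = 1" if "i < n" for i using that R by (simp add: w_def)
  have wS: "w (Suc k) i = (\<Sum>j<n. R $$ (i, j) * w k j)" if "i < n" for k i
  proof -
    have "(R ^\<^sub>m Suc k) $$ (i, j) = (\<Sum>p<n. R $$ (i, p) * (R ^\<^sub>m k) $$ (p, j))" if "j < n" for j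
      unfolding pow_mat_Suc_left[OF R] using R pow_carrier_mat[OF R, of k] that \<open>i < n\<close>
      by (simp add: scalar_prod_def atLeast0LessThan)
    then have "w (Suc k) i = (\<Sum>j<n. \<Sum>p<n. R $$ (i, p) * (R ^\<^sub>m k) $$ (p, j))"
      unfolding w_def by (intro sum.cong) auto
    also have "\<dots> = (\<Sum>p<n. R $$ (i, p) * w k p)"
      by (subst sum.swap) (simp add: w_def sum_distrib_left)
    finally show ?thesis .
  qed
  have w_nonneg: "0 \<le> w k i" if "i < n" for k i
    using that
  proof (induction k arbitrary: i)
    case (Suc k)
    then show ?case unfolding wS[OF Suc.prems] using P nn b(3)
      by (intro sum_nonneg mult_nonneg_nonneg) (auto simp: R_def)
  qed (simp add: w0)
  have w_le: "w k i \<le> n * c" if "i < n" for k i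
    unfolding w_def using sum_bounded_above[of "{..<n}" "\<lambda>j. (R ^\<^sub>m k) $$ (i, j)" c] c' that by simp
  define t where "t = b / \<beta>"
  have t: "0 < t" "t < 1" using b by (auto simp: t_def)
  have "(\<lambda>k. real n * c * t ^ k) \<longlonglongrightarrow> real n * c * 0"
    using t by (intro tendsto_mult tendsto_const LIMSEQ_realpow_zero) auto
  then have "eventually (\<lambda>k. real n * c * t ^ k < 1) sequentially"
    by (intro order_tendstoD(2)) auto
  then obtain K where K: "real n * c * t ^ K < 1"
    by (auto simp: eventually_sequentially)
  define x where "x i = (\<Sum>k<K. t ^ k * w k i)" for i
  have Px: "(\<Sum>j<n. P $$ (i, j) * x j) < \<beta> * x i" if i: "i < n" for i
  proof -
    have "(\<Sum>j<n. P $$ (i, j) * x j) = (\<Sum>j<n. \<Sum>k<K. b * (t ^ k * (R $$ (i, j) * w k j)))"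
      using P i b(3) by (intro sum.cong) (auto simp: x_def R_def sum_distrib_left mult.left_commute)
    also have "\<dots> = (\<Sum>k<K. b * (t ^ k * w (Suc k) i))"
      by (subst sum.swap) (simp add: wS[OF i] sum_distrib_left)
    also have "\<dots> = \<beta> * (\<Sum>k<K. t ^ Suc k * w (Suc k) i)"
      using b by (simp add: t_def sum_distrib_left mult.assoc)
    \<comment> \<open>The sum telescopes against \<open>x\<close>, whose term for \<open>k = 0\<close> is 1.\<close>
    also have "(\<Sum>k<K. t ^ Suc k * w (Suc k) i) = x i - 1 + t ^ K * w K i"
      using sum.lessThan_Suc_shift[of "\<lambda>k. t ^ k * w k i" K] w0[OF i] by (simp add: x_def)
    also have "\<beta> * (x i - 1 + t ^ K * w K i) < \<beta> * x i"
    proof -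
      have "t ^ K * w K i \<le> t ^ K * (n * c)" using w_le[OF i] t by (intro mult_left_mono) auto
      then have "x i - 1 + t ^ K * w K i < x i" using K by (simp add: mult.commute)
      then show ?thesis using b by (intro mult_strict_left_mono) auto
    qed
    finally show ?thesis .
  qed
  have x_nonneg: "0 \<le> x i" if "i < n" for i
    unfolding x_def using t w_nonneg[OF that] by (intro sum_nonneg mult_nonneg_nonneg) auto
  have "0 < x i" if "i < n" for i
  proof -
    have "0 \<le> (\<Sum>j<n. P $$ (i, j) * x j)"
      using nn x_nonneg that by (intro sum_nonneg mult_nonneg_nonneg) auto
    with Px[OF that] have "0 < \<beta> * x i" by linarith
    then show ?thesis using b by (simp add: zero_less_mult_iff)
  qed
  then show ?thesis using Px by blast
qed simp

text \<open>The entries of an eigenvector are compared with \<open>x\<close> where the ratio of the moduli is greatest.\<close>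
lemma subinvariant_imp_spectral_radius_less:
  assumes P: "P \<in> carrier_mat n n" and nn: "\<And>i j. i < n \<Longrightarrow> j < n \<Longrightarrow> 0 \<le> P $$ (i, j)" and n: "0 < n"
    and x: "\<And>i. i < n \<Longrightarrow> 0 < x i \<and> (\<Sum>j<n. P $$ (i, j) * x j) < \<beta> * x i"
  shows "spectral_radius (map_mat complex_of_real P) < \<beta>"
proof -
  let ?C = "map_mat complex_of_real P"
  have C: "?C \<in> carrier_mat n n" using P by simp
  obtain z v where z: "norm z = spectral_radius ?C" and v: "eigenvector ?C v z"
    using spectral_radius_mem_max(1)[OF C n] by (auto simp: spectrum_def eigenvalue_def)
  have vc: "v \<in> carrier_vec n" "v \<noteq> 0\<^sub>v n" using v P by (auto simp: eigenvector_def)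
  then obtain q where q: "q < n" "v $ q \<noteq> 0" by (metis carrier_vecD eq_vecI index_zero_vec(1,2))
  define M where "M = Max ((\<lambda>i. norm (v $ i) / x i) ` {..<n})"
  have "M \<in> (\<lambda>i. norm (v $ i) / x i) ` {..<n}" unfolding M_def using n by (intro Max_in) auto
  then obtain m where m: "m < n" "M = norm (v $ m) / x m" by auto
  have le: "norm (v $ i) / x i \<le> M" if "i < n" for i
    unfolding M_def using that by (intro Max_ge) auto
  have "0 < norm (v $ q) / x q" using q x by simp
  with le[OF q(1)] have "0 < M" by linarith
  have "norm z * norm (v $ m) = norm ((?C *\<^sub>v v) $ m)"
    using v vc m by (simp add: eigenvector_def norm_mult)
  also have "\<dots> = norm (\<Sum>j<n. complex_of_real (P $$ (m, j)) * v $ j)"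
    using mat_vec_entry[OF C vc(1) m(1)] P m by simp
  also have "\<dots> \<le> (\<Sum>j<n. norm (complex_of_real (P $$ (m, j)) * v $ j))" by (rule norm_sum)
  also have "\<dots> \<le> (\<Sum>j<n. P $$ (m, j) * (M * x j))"
  proof (rule sum_mono)
    fix j assume "j \<in> {..<n}"
    then have "norm (v $ j) \<le> M * x j" "0 \<le> P $$ (m, j)"
      using le[of j] x[of j] nn m by (auto simp: field_simps)
    then show "norm (complex_of_real (P $$ (m, j)) * v $ j) \<le> P $$ (m, j) * (M * x j)"
      by (simp add: norm_mult mult_left_mono)
  qed
  also have "\<dots> = M * (\<Sum>j<n. P $$ (m, j) * x j)" by (simp add: sum_distrib_left mult.left_commute)
  also have "\<dots> < M * (\<beta> * x m)" using \<open>0 < M\<close> x m by (intro mult_strict_left_mono) auto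
  also have "M * x m = norm (v $ m)" using m x[OF m(1)] by simp
  then have "M * (\<beta> * x m) = \<beta> * norm (v $ m)" by (simp add: mult.left_commute)
  finally have "norm z * norm (v $ m) < \<beta> * norm (v $ m)" .
  moreover have "0 \<le> norm (v $ m)" by simp
  ultimately show ?thesis unfolding z[symmetric] by (meson mult_right_less_imp_less)
qed

lemma M_matrix_iff_M_on:
  assumes A: "A \<in> carrier_mat n n"
  shows "M_matrix A \<longleftrightarrow> M_on {..<n} (\<lambda>i j. A $$ (i, j))"
proof
  have n: "dim_row A = n" using A by simp
  have row: "(\<Sum>j<n. A $$ (i, j) * x j) = \<alpha> * x i - (\<Sum>j<n. P $$ (i, j) * x j)"
    if "i < n" "P \<in> carrier_mat n n" "A = \<alpha> \<cdot>\<^sub>m 1\<^sub>m n - P" for i x \<alpha> P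
  proof -
    have "(\<Sum>j<n. A $$ (i, j) * x j) = (\<Sum>j<n. (if i = j then \<alpha> * x j else 0) - P $$ (i, j) * x j)"
      using that by (intro sum.cong) (auto simp: algebra_simps)
    then show ?thesis using that by (simp add: sum_subtractf)
  qed
  show "M_on {..<n} (\<lambda>i j. A $$ (i, j))" if "M_matrix A"
  proof -
    from that obtain \<alpha> P where P: "P \<in> carrier_mat n n" "\<And>i j. i < n \<Longrightarrow> j < n \<Longrightarrow> 0 \<le> P $$ (i, j)"
      and sr: "spectral_radius (map_mat complex_of_real P) \<le> \<alpha>" and AP: "A = \<alpha> \<cdot>\<^sub>m 1\<^sub>m n - P"
      unfolding M_matrix_def n by blast
    show ?thesis unfolding M_on_def
    proof (intro conjI allI impI)
      show "Z_on {..<n} (\<lambda>i j. A $$ (i, j))" unfolding Z_on_def using P by (auto simp: AP)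
      fix \<epsilon> :: real assume "0 < \<epsilon>"
      then obtain x where "\<forall>i<n. 0 < x i \<and> (\<Sum>j<n. P $$ (i, j) * x j) < (\<alpha> + \<epsilon>) * x i"
        using spectral_radius_less_imp_subinvariant[OF P, of "\<alpha> + \<epsilon>"] sr by auto
      then show "\<exists>x. almost_semipos {..<n} (\<lambda>i j. A $$ (i, j)) \<epsilon> x"
        unfolding almost_semipos_def using row[OF _ P(1) AP, of _ x]
        by (intro exI[of _ x]) (auto simp: distrib_right)
    qed
  qed
  show "M_matrix A" if M: "M_on {..<n} (\<lambda>i j. A $$ (i, j))"
  proof -
    \<comment> \<open>For \<open>n = 0\<close> the spectral radius is an unspecified number, so it is chosen as \<open>\<alpha>\<close> itself.\<close>
    define \<alpha> where "\<alpha> = (if n = 0 then spectral_radius (map_mat complex_of_real A) else (\<Sum>i<n. A $$ (i, i)))"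
    define P where "P = \<alpha> \<cdot>\<^sub>m 1\<^sub>m n - A"
    have P: "P \<in> carrier_mat n n" unfolding P_def using A by (rule minus_carrier_mat)
    have AP: "A = \<alpha> \<cdot>\<^sub>m 1\<^sub>m n - P" using A by (intro eq_matI) (auto simp: P_def)
    have nn: "0 \<le> P $$ (i, j)" if ij: "i < n" "j < n" for i j
    proof (cases "i = j")
      case True
      have "A $$ (i, i) \<le> (\<Sum>i<n. A $$ (i, i))"
        using ij M_on_diag_nonneg[OF _ M] by (intro member_le_sum) auto
      then show ?thesis using True ij A by (simp add: P_def \<alpha>_def)
    next
      case False
      then show ?thesis using ij A Z_onD[OF M_on_Z[OF M], of i j] by (simp add: P_def)
    qed
    have "spectral_radius (map_mat complex_of_real P) \<le> \<alpha>"
    proof (cases "n = 0")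
      case True
      then have "P = A" using A P by (intro eq_matI) auto
      then show ?thesis using True by (simp add: \<alpha>_def)
    next
      case False
      show ?thesis
      proof (rule field_le_epsilon)
        fix \<epsilon> :: real assume "0 < \<epsilon>"
        then obtain x where x: "almost_semipos {..<n} (\<lambda>i j. A $$ (i, j)) \<epsilon> x"
          using M by (auto simp: M_on_def)
        have "spectral_radius (map_mat complex_of_real P) < \<alpha> + \<epsilon>"
        proof (rule subinvariant_imp_spectral_radius_less[OF P nn, where x = x])
          fix i assume i: "i < n"
          then show "0 < x i \<and> (\<Sum>j<n. P $$ (i, j) * x j) < (\<alpha> + \<epsilon>) * x i"
            using almost_semiposD[OF x, of i] row[OF i P AP, of x] by (simp add: algebra_simps)
        qed (use False in auto)
        then show "spectral_radius (map_mat complex_of_real P) \<le> \<alpha> + \<epsilon>" by simp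
      qed
    qed
    then show ?thesis unfolding M_matrix_def n using P nn AP by blast
  qed
qed

section \<open>Singular classes of matrices\<close>

lemma bij_betw_pick:
  assumes "finite J"
  shows "bij_betw (pick J) {..<card J} J"
proof -
  have "inj_on (pick J) {..<card J}"
    by (rule inj_onI) (metis card_pick_le lessThan_iff)
  moreover have "pick J ` {..<card J} \<subseteq> J" using pick_in_set_le by auto
  ultimately show ?thesis
    using assms by (simp add: bij_betw_def card_image card_subset_eq)
qed

text \<open>Vectors on \<open>J\<close> and vectors of length \<open>card J\<close> are matched by \<open>pick J\<close>, the enumeration of \<open>J\<close> that
  \<open>submatrix\<close> uses; \<open>g\<close> is its inverse.\<close>
lemma det_submatrix_eq_0_iff:
  assumes A: "A \<in> carrier_mat n n" and J: "J \<subseteq> {..<n}" and M: "M_on J (\<lambda>i j. A $$ (i, j))"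
  shows "det (submatrix A J J) = 0 \<longleftrightarrow> \<not> semipos_on J (\<lambda>i j. A $$ (i, j))"
proof -
  define N where "N = card J"
  let ?B = "submatrix A J J" and ?a = "\<lambda>i j. A $$ (i, j)"
  have fin: "finite J" using J finite_subset by blast
  have Jn: "{i. i < n \<and> i \<in> J} = J" using J by auto
  have B: "?B \<in> carrier_mat N N" using A Jn by (intro carrier_matI) (simp_all only: dim_submatrix N_def carrier_matD)
  have Bij: "?B $$ (i, j) = A $$ (pick J i, pick J j)" if "i < N" "j < N" for i j
    using that A Jn by (intro submatrix_index) (auto simp: N_def)
  have bij: "bij_betw (pick J) {..<N} J" unfolding N_def using fin by (rule bij_betw_pick)
  define g where "g = the_inv_into {..<N} (pick J)"
  have g: "g (pick J i) = i" if "i < N" for i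
    using bij that unfolding g_def bij_betw_def by (intro the_inv_into_f_f) auto
  have entry: "(\<Sum>j\<in>J. ?a (pick J i) j * v $ g j) = (?B *\<^sub>v v) $ i"
    if "i < N" "v \<in> carrier_vec N" for i v
  proof -
    have "(\<Sum>j\<in>J. ?a (pick J i) j * v $ g j) = (\<Sum>q<N. ?a (pick J i) (pick J q) * v $ g (pick J q))"
      by (rule sum.reindex_bij_betw[OF bij, symmetric])
    also have "\<dots> = (\<Sum>q<N. ?B $$ (i, q) * v $ q)"
      using that(1) g Bij by (intro sum.cong) auto
    finally show ?thesis using mat_vec_entry[OF B that(2,1)] by simp
  qed
  have surj: "\<exists>i<N. j = pick J i" if "j \<in> J" for j
    using bij that unfolding bij_betw_def by auto
  show ?thesis
  proof
    assume "det ?B = 0"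
    then obtain v where v: "v \<in> carrier_vec N" "v \<noteq> 0\<^sub>v N" "?B *\<^sub>v v = 0\<^sub>v N"
      using det_0_iff_vec_prod_zero[OF B] by blast
    then obtain q where q: "q < N" "v $ q \<noteq> 0" by (metis carrier_vecD eq_vecI index_zero_vec(1,2))
    have zero: "(\<Sum>j\<in>J. ?a i j * v $ g j) = 0" if "i \<in> J" for i
      using surj[OF that] entry[OF _ v(1)] v(3) by auto
    have pq: "pick J q \<in> J" using q by (auto simp: N_def pick_in_set_le)
    show "\<not> semipos_on J ?a"
    proof
      assume s: "semipos_on J ?a"
      have "0 \<le> v $ g (pick J q)"
        using semipos_imp_inverse_nonneg[OF fin M_on_Z[OF M] s, of "\<lambda>j. v $ g j", OF _ pq] zero by simp
      moreover have "0 \<le> - v $ g (pick J q)"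
        using semipos_imp_inverse_nonneg[OF fin M_on_Z[OF M] s, of "\<lambda>j. - v $ g j", OF _ pq] zero
        by (simp add: sum_negf)
      ultimately show False using q g[OF q(1)] by simp
    qed
  next
    assume ns: "\<not> semipos_on J ?a"
    show "det ?B = 0"
    proof (rule ccontr)
      assume "det ?B \<noteq> 0"
      from det_non_zero_imp_unit[OF B this] obtain C where C: "C \<in> carrier_mat N N" "?B * C = 1\<^sub>m N"
        unfolding Units_def ring_mat_def by auto
      define v where "v = C *\<^sub>v vec N (\<lambda>_. 1)"
      have v: "v \<in> carrier_vec N" using C by (simp add: v_def)
      have "?B *\<^sub>v v = vec N (\<lambda>_. 1)"
        unfolding v_def using C assoc_mult_mat_vec[OF B C(1), of "vec N (\<lambda>_. 1)"] by simp
      then have "(\<Sum>j\<in>J. ?a i j * v $ g j) = 1" if "i \<in> J" for i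
        using surj[OF that] entry[OF _ v] by auto
      then show False using M_on_solution_imp_semipos[OF fin M, of "\<lambda>j. v $ g j"] ns by blast
    qed
  qed
qed

lemma has_access_iff:
  assumes "A \<in> carrier_mat n n"
  shows "has_access A j k \<longleftrightarrow> j < n \<and> k < n \<and> access_on {..<n} (\<lambda>i j. A $$ (i, j)) j k"
proof -
  have "edges A = {(i, j). i \<in> {..<n} \<and> j \<in> {..<n} \<and> A $$ (i, j) \<noteq> 0}"
    using assms by (auto simp: edges_def)
  then show ?thesis using assms by (simp add: has_access_def access_on_def)
qed

lemma access_classes_eq:
  assumes "A \<in> carrier_mat n n"
  shows "access_classes A = class_on {..<n} (\<lambda>i j. A $$ (i, j)) ` {..<n}"
proof -
  have "{(j, k). has_access A j k \<and> has_access A k j} `` {s} = class_on {..<n} (\<lambda>i j. A $$ (i, j)) s"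
    if "s < n" for s
    using that by (auto simp: has_access_iff[OF assms] class_on_def)
  then show ?thesis using assms by (auto simp: access_classes_def quotient_def)
qed

lemma class_on_eq:
  assumes "t \<in> class_on I a s"
  shows "class_on I a t = class_on I a s"
proof -
  have st: "access_on I a s t" "access_on I a t s" using assms by (auto simp: class_on_def)
  have "access_on I a t p \<longleftrightarrow> access_on I a s p" "access_on I a p t \<longleftrightarrow> access_on I a p s" for p
    using access_on_trans[OF st(1), of p] access_on_trans[OF st(2), of p] access_on_trans[OF _ st(1), of p]
      access_on_trans[OF _ st(2), of p] by blast+
  then show ?thesis by (simp add: class_on_def)
qed

text \<open>The sets \<open>F_set\<close> and \<open>T_set\<close> have this form, with \<open>s\<close> the greatest index of the class.\<close>
lemma cut_eq_singleton_iff: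
  fixes s n :: nat
  assumes "s < n" "Q s"
  shows "{l. l < n \<and> s \<le> l \<and> (\<exists>j\<ge>l. j < n \<and> Q j)} = {s} \<longleftrightarrow> (\<forall>j\<in>{..<n}. s < j \<longrightarrow> \<not> Q j)"
    (is "?T = _ \<longleftrightarrow> _")
proof
  assume T: "?T = {s}"
  show "\<forall>j\<in>{..<n}. s < j \<longrightarrow> \<not> Q j"
  proof (intro ballI impI notI)
    fix j assume "j \<in> {..<n}" "s < j" "Q j"
    then have "j \<in> ?T" by auto
    with T \<open>s < j\<close> show False by simp
  qed
next
  assume h: "\<forall>j\<in>{..<n}. s < j \<longrightarrow> \<not> Q j"
  have "l = s" if l: "l \<in> ?T" for l
  proof -
    from l obtain j where "s \<le> l" "l \<le> j" "j < n" "Q j" by blast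
    with h have "\<not> s < j" by blast
    with \<open>s \<le> l\<close> \<open>l \<le> j\<close> show ?thesis by simp
  qed
  moreover have "s \<in> ?T" using assms by blast
  ultimately show "?T = {s}" by blast
qed

lemma T_set_class_singleton_iff:
  assumes A: "A \<in> carrier_mat n n" and s: "s < n" "Max J = s" and J: "J = class_on {..<n} (\<lambda>i j. A $$ (i, j)) s"
  shows "T_set A J = {s} \<longleftrightarrow> (\<forall>j\<in>{..<n}. s < j \<longrightarrow> \<not> access_on {..<n} (\<lambda>i j. A $$ (i, j)) j s)"
proof -
  have h: "has_access_to_class A j J \<longleftrightarrow> j < n \<and> access_on {..<n} (\<lambda>i j. A $$ (i, j)) j s" for j
    unfolding has_access_to_class_def has_access_iff[OF A] J class_on_def using s
    by (auto intro: access_on_trans)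
  have "T_set A J = {l. l < n \<and> s \<le> l \<and> (\<exists>j\<ge>l. j < n \<and> access_on {..<n} (\<lambda>i j. A $$ (i, j)) j s)}"
    using A s by (simp add: T_set_def h)
  then show ?thesis using cut_eq_singleton_iff[OF s(1)] by simp
qed

lemma F_set_class_singleton_iff:
  assumes A: "A \<in> carrier_mat n n" and s: "s < n" "Max J = s" and J: "J = class_on {..<n} (\<lambda>i j. A $$ (i, j)) s"
  shows "F_set A J = {s} \<longleftrightarrow> (\<forall>j\<in>{..<n}. s < j \<longrightarrow> \<not> access_on {..<n} (\<lambda>i j. A $$ (i, j)) s j)"
proof -
  have h: "accessed_from_class A j J \<longleftrightarrow> j < n \<and> access_on {..<n} (\<lambda>i j. A $$ (i, j)) s j" for j
    unfolding accessed_from_class_def has_access_iff[OF A] J class_on_def using s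
    by (auto intro: access_on_trans)
  have "F_set A J = {l. l < n \<and> s \<le> l \<and> (\<exists>j\<ge>l. j < n \<and> access_on {..<n} (\<lambda>i j. A $$ (i, j)) s j)}"
    using A s by (simp add: F_set_def h)
  then show ?thesis using cut_eq_singleton_iff[OF s(1)] by simp
qed

lemma one_sided_iff_T_F:
  assumes A: "A \<in> carrier_mat n n" and "M_matrix A"
  shows "one_sided {..<n} (\<lambda>i j. A $$ (i, j)) \<longleftrightarrow>
    (\<forall>J\<in>singular_classes A. T_set A J = {Max J} \<or> F_set A J = {Max J})"
proof -
  let ?a = "\<lambda>i j. A $$ (i, j)"
  have M: "M_on {..<n} ?a" using assms M_matrix_iff_M_on by blast
  have sub: "class_on {..<n} ?a s \<subseteq> {..<n}" for s by (auto simp: class_on_def)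
  have fin: "finite (class_on {..<n} ?a s)" for s by (rule finite_subset[OF sub]) simp
  have Max: "Max (class_on {..<n} ?a s) = s" if "s < n" "\<forall>t\<in>class_on {..<n} ?a s. t \<le> s" for s
    using that self_in_class_on[of s "{..<n}" ?a] fin by (intro Max_eqI) auto
  have sing: "singular_classes A = {J. \<exists>s<n. J = class_on {..<n} ?a s \<and> \<not> semipos_on J ?a}"
    unfolding singular_classes_def access_classes_eq[OF A]
    using det_submatrix_eq_0_iff[OF A sub M_on_subset[OF _ M sub]] by auto
  have lead: "\<exists>s<n. J = class_on {..<n} ?a s \<and> (\<forall>t\<in>class_on {..<n} ?a s. t \<le> s)"
    if r: "r < n" "J = class_on {..<n} ?a r" for J r
  proof -
    have "Max J \<in> J" unfolding r using fin self_in_class_on[of r "{..<n}" ?a] r(1) by (intro Max_in) auto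
    then have 1: "J = class_on {..<n} ?a (Max J)" using class_on_eq[of "Max J" "{..<n}" ?a r] r(2) by simp
    moreover have "Max J < n" using \<open>Max J \<in> J\<close> r sub by blast
    moreover have "\<forall>t\<in>J. t \<le> Max J" using fin r(2) by simp
    ultimately show ?thesis by metis
  qed
  have TF: "(\<forall>j\<in>{..<n}. s < j \<longrightarrow> \<not> access_on {..<n} ?a j s) \<or> (\<forall>j\<in>{..<n}. s < j \<longrightarrow> \<not> access_on {..<n} ?a s j)
      \<longleftrightarrow> T_set A (class_on {..<n} ?a s) = {Max (class_on {..<n} ?a s)} \<or> F_set A (class_on {..<n} ?a s) = {Max (class_on {..<n} ?a s)}"
    if "s < n" "\<forall>t\<in>class_on {..<n} ?a s. t \<le> s" for s
    unfolding Max[OF that] T_set_class_singleton_iff[OF A that(1) Max[OF that] refl]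
      F_set_class_singleton_iff[OF A that(1) Max[OF that] refl] ..
  have "(\<forall>J\<in>singular_classes A. T_set A J = {Max J} \<or> F_set A J = {Max J}) \<longleftrightarrow>
    (\<forall>s<n. (\<forall>t\<in>class_on {..<n} ?a s. t \<le> s) \<and> \<not> semipos_on (class_on {..<n} ?a s) ?a \<longrightarrow>
      T_set A (class_on {..<n} ?a s) = {Max (class_on {..<n} ?a s)} \<or> F_set A (class_on {..<n} ?a s) = {Max (class_on {..<n} ?a s)})"
    (is "?lhs \<longleftrightarrow> ?r")
  proof
    assume ?lhs
    then show ?r unfolding sing by blast
  next
    assume r: ?r
    show ?lhs
    proof
      fix J assume "J \<in> singular_classes A"
      then obtain q where q: "q < n" "J = class_on {..<n} ?a q" "\<not> semipos_on J ?a"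
        unfolding sing by blast
      obtain s where s: "s < n" "J = class_on {..<n} ?a s" "\<forall>t\<in>class_on {..<n} ?a s. t \<le> s"
        using lead[OF q(1,2)] by blast
      show "T_set A J = {Max J} \<or> F_set A J = {Max J}"
        using r s q(3) by blast
    qed
  qed
  moreover have "one_sided {..<n} ?a \<longleftrightarrow> (\<forall>s<n. (\<forall>t\<in>class_on {..<n} ?a s. t \<le> s) \<and> \<not> semipos_on (class_on {..<n} ?a s) ?a \<longrightarrow>
      T_set A (class_on {..<n} ?a s) = {Max (class_on {..<n} ?a s)} \<or> F_set A (class_on {..<n} ?a s) = {Max (class_on {..<n} ?a s)})"
    unfolding one_sided_def using TF by (metis lessThan_iff)
  ultimately show ?thesis by blast
qed

section \<open>Factorizations of matrices\<close>

lemma lower_M_matrix_iff: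
  assumes L: "L \<in> carrier_mat n n"
  shows "lower_triangular L \<and> M_matrix L \<longleftrightarrow> lower_on {..<n} (\<lambda>i j. L $$ (i, j))"
proof
  assume h: "lower_triangular L \<and> M_matrix L"
  then have M: "M_on {..<n} (\<lambda>i j. L $$ (i, j))" using M_matrix_iff_M_on[OF L] by simp
  show "lower_on {..<n} (\<lambda>i j. L $$ (i, j))"
    using h L M_on_Z[OF M] M_on_diag_nonneg[OF _ M] by (auto simp: lower_on_def lower_triangular_def)
next
  assume "lower_on {..<n} (\<lambda>i j. L $$ (i, j))"
  then show "lower_triangular L \<and> M_matrix L"
    using triangular_M_on(1) L by (auto simp: M_matrix_iff_M_on[OF L] lower_triangular_def lower_on_def)
qed

lemma upper_M_matrix_iff:
  assumes U: "U \<in> carrier_mat n n"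
  shows "upper_triangular U \<and> M_matrix U \<longleftrightarrow> upper_on {..<n} (\<lambda>i j. U $$ (i, j))"
proof
  assume h: "upper_triangular U \<and> M_matrix U"
  then have M: "M_on {..<n} (\<lambda>i j. U $$ (i, j))" using M_matrix_iff_M_on[OF U] by simp
  show "upper_on {..<n} (\<lambda>i j. U $$ (i, j))"
    using h U M_on_Z[OF M] M_on_diag_nonneg[OF _ M] by (auto simp: upper_on_def upper_triangular_def)
next
  assume "upper_on {..<n} (\<lambda>i j. U $$ (i, j))"
  then show "upper_triangular U \<and> M_matrix U"
    using triangular_M_on(2) U by (auto simp: M_matrix_iff_M_on[OF U] upper_triangular_def upper_on_def)
qed

lemma factorization_iff:
  assumes A: "A \<in> carrier_mat n n" and M: "M_matrix A"
  shows "(\<exists>L U. L \<in> carrier_mat n n \<and> U \<in> carrier_mat n n \<and>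
            lower_triangular L \<and> M_matrix L \<and> upper_triangular U \<and> M_matrix U \<and> A = L * U)
     \<longleftrightarrow> one_sided {..<n} (\<lambda>i j. A $$ (i, j))"
proof
  have Ma: "M_on {..<n} (\<lambda>i j. A $$ (i, j))" using assms M_matrix_iff_M_on by blast
  have entry: "(L * U) $$ (i, j) = (\<Sum>p<n. L $$ (i, p) * U $$ (p, j))"
    if "L \<in> carrier_mat n n" "U \<in> carrier_mat n n" "i < n" "j < n" for L U :: "real mat" and i j
    using that by (simp add: scalar_prod_def atLeast0LessThan)
  {
    assume "\<exists>L U. L \<in> carrier_mat n n \<and> U \<in> carrier_mat n n \<and>
            lower_triangular L \<and> M_matrix L \<and> upper_triangular U \<and> M_matrix U \<and> A = L * U"
    then obtain L U where LU: "L \<in> carrier_mat n n" "U \<in> carrier_mat n n"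
            "lower_triangular L \<and> M_matrix L" "upper_triangular U \<and> M_matrix U" "A = L * U" by blast
    show "one_sided {..<n} (\<lambda>i j. A $$ (i, j))"
      using LU(3,4) M_on_Z[OF Ma] entry[OF LU(1,2)]
      unfolding lower_M_matrix_iff[OF LU(1)] upper_M_matrix_iff[OF LU(2)] LU(5)
      by (intro factorization_imp_one_sided) auto
  next
    assume "one_sided {..<n} (\<lambda>i j. A $$ (i, j))"
    then obtain l u where lu: "lower_on {..<n} l" "upper_on {..<n} u"
      "\<forall>i\<in>{..<n}. \<forall>j\<in>{..<n}. A $$ (i, j) = (\<Sum>p<n. l i p * u p j)"
      using one_sided_imp_factorization[OF _ Ma] by auto
    define L where "L = mat n n (\<lambda>(i, j). l i j)"
    define U where "U = mat n n (\<lambda>(i, j). u i j)"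
    have c: "L \<in> carrier_mat n n" "U \<in> carrier_mat n n" by (auto simp: L_def U_def)
    have "lower_on {..<n} (\<lambda>i j. L $$ (i, j))" "upper_on {..<n} (\<lambda>i j. U $$ (i, j))"
      using lu(1,2) by (auto simp: lower_on_def upper_on_def Z_on_def L_def U_def)
    moreover have "A = L * U"
    proof (rule eq_matI)
      fix i j assume "i < dim_row (L * U)" "j < dim_col (L * U)"
      then have ij: "i < n" "j < n" using c by auto
      have "(L * U) $$ (i, j) = (\<Sum>p<n. l i p * u p j)"
        unfolding entry[OF c ij] using ij by (intro sum.cong) (auto simp: L_def U_def)
      then show "A $$ (i, j) = (L * U) $$ (i, j)" using lu(3) ij by simp
    qed (use A c in auto)
    ultimately show "\<exists>L U. L \<in> carrier_mat n n \<and> U \<in> carrier_mat n n \<and>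
            lower_triangular L \<and> M_matrix L \<and> upper_triangular U \<and> M_matrix U \<and> A = L * U"
      using lower_M_matrix_iff[OF c(1)] upper_M_matrix_iff[OF c(2)] c by blast
  }
qed

theorem corollary3p9:
  fixes A :: "real mat" and n m :: nat and S :: "nat \<Rightarrow> nat set" and \<mu> :: "nat \<Rightarrow> nat"
  assumes "A \<in> carrier_mat n n"
    and "M_matrix A"
    and "S ` {1..m} = singular_classes A"
    and "\<And>i. i \<in> {1..m} \<Longrightarrow> \<mu> i = Max (S i)"
    and "\<And>i. i \<in> {1..<m} \<Longrightarrow> \<mu> i < \<mu> (Suc i)"
  shows "(\<exists>L U. L \<in> carrier_mat n n \<and> U \<in> carrier_mat n n \<and>
            lower_triangular L \<and> M_matrix L \<and> upper_triangular U \<and> M_matrix U \<and> A = L * U)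
     \<longleftrightarrow> (\<forall>i \<in> {1..m}. T_set A (S i) = {\<mu> i} \<or> F_set A (S i) = {\<mu> i})"
  unfolding factorization_iff[OF assms(1,2)] one_sided_iff_T_F[OF assms(1,2)] assms(3)[symmetric]
  using assms(4) by auto

end
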